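(* Let $(M,F)$ be a complex Finsler space of complex dimension $2$. Then: (i) $K^v_{F,l}(z,\eta)=0$; (ii) $K^v_{F,m}(z,\eta)=2\mathbf I$, and $\mathbf I$ is real valued; (iii) $\mathbf I|_0=-\mathbf I$.
   Context: $M$ is a complex manifold with $\dim_{\mathbb C}M=2$; $T'M$ is its holomorphic tangent bundle with local coordinates $(z^k,\eta^k)_{k=1,2}$; $\widetilde{T'M}$ is $T'M$ minus the zero section. A complex Finsler space $(M,F)$: $F:T'M\to[0,\infty)$ is continuous, $L:=F^2$ is smooth on $\widetilde{T'M}$, $F(z,\eta)=0$ iff $\eta=0$, $F(z,\lambda\eta)=|\lambda|F(z,\eta)$ for all $\lambda\in\mathbb C$, and the Hermitian matrix $g_{i\bar j}:=\partial^2L/\partial\eta^i\partial\bar\eta^j$ is positive definite on $\widetilde{T'M}$. Repeated indices are summed over $\{1,2\}$; everything lives on $\widetilde{T'M}$; barred indices denote conjugate components. $(g^{\bar m i})$ is the inverse matrix: $g^{\bar m i}g_{j\bar m}=\delta^i_j$. $\dot\partial_k:=\partial/\partial\eta^k$, $\dot\partial_{\bar k}:=\partial/\partial\bar\eta^k$, $C^i_{jk}:=g^{\bar li}\dot\partial_kg_{j\bar l}$ (vertical Chern–Finsler coefficients). The $v\bar v$-Riemann type tensor is $S_{\bar rj\bar hk}:=-g_{i\bar r}\dot\partial_{\bar h}C^i_{jk}$. In a fixed local chart: $l^i:=\eta^i/F$, $l_i:=\frac1Fg_{i\bar j}\bar\eta^j$, $g:=\det(g_{i\bar j})$, $m^1:=-l_2/\sqrt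 g$, $m^2:=l_1/\sqrt g$, $m_1:=-\sqrt g\,l^2$, $m_2:=\sqrt g\,l^1$, with $l^{\bar i}:=\overline{l^i}$, $m^{\bar i}:=\overline{m^i}$, etc. ($l=l^i\dot\partial_i$, $m=m^i\dot\partial_i$ is an orthonormal vertical frame for $g_{i\bar j}$). Put $B:=m_hm^km^jC^h_{jk}$. For a function $f$: $f|_k:=\dot\partial_kf$, $f|_{\bar k}:=\dot\partial_{\bar k}f$, $f|_0:=\eta^k\dot\partial_kf$. The vertical curvature invariant is $\mathbf I:=-B|_{\bar s}m^{\bar s}-\frac12B\bar B$. The vertical holomorphic sectional curvatures in directions $l$ and $m$ are $K^v_{F,l}:=2S_{\bar rj\bar hk}l^{\bar r}l^jl^{\bar h}l^k$ and $K^v_{F,m}:=2S_{\bar rj\bar hk}m^{\bar r}m^jm^{\bar h}m^k$. *)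

theory Defs
  imports "HOL-Analysis.Analysis"
begin

section \<open>Smooth maps and holomorphic maps of several variables\<close>

text \<open>For open \<open>S\<close>, this is \<open>C\<^sup>n\<close> in the real sense.\<close>

primrec Ck_on :: "nat \<Rightarrow> 'a::real_normed_vector set \<Rightarrow> ('a \<Rightarrow> 'b::real_normed_vector) \<Rightarrow> bool" where
  "Ck_on 0 S f \<longleftrightarrow> continuous_on S f"
| "Ck_on (Suc n) S f \<longleftrightarrow>
     (\<forall>x\<in>S. f differentiable (at x)) \<and>
     (\<forall>v. Ck_on n S (\<lambda>x. frechet_derivative f (at x) v))"

definition smooth_on :: "'a::real_normed_vector set \<Rightarrow> ('a \<Rightarrow> 'b::real_normed_vector) \<Rightarrow> bool" where
  "smooth_on S f \<longleftrightarrow> (\<forall>n. Ck_on n S f)"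

text \<open>The derivative at each point is given by a complex Jacobian matrix, i.e. it is complex linear.\<close>

definition holomorphic_map_on ::
    "(complex^('n::finite)) set \<Rightarrow> (complex^'n \<Rightarrow> complex^('m::finite)) \<Rightarrow> bool" where
  "holomorphic_map_on S f \<longleftrightarrow>
     (\<forall>z\<in>S. \<exists>J::complex^'n^'m. (f has_derivative (\<lambda>h. J *v h)) (at z))"


section \<open>Complex manifolds\<close>

text \<open>A chart \<open>c = (U, \<phi>)\<close>; the values of \<open>\<phi>\<close> outside \<open>U\<close> are irrelevant.\<close>

type_synonym ('a, 'n) chart = "'a set \<times> ('a \<Rightarrow> complex^'n)"

abbreviation chart_dom :: "('a, 'n) chart \<Rightarrow> 'a set" where
  "chart_dom c \<equiv> fst c"

abbreviation chart_map :: "('a, 'n) chart \<Rightarrow> 'a \<Rightarrow> complex^'n" where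
  "chart_map c \<equiv> snd c"

abbreviation chart_range :: "('a, 'n) chart \<Rightarrow> (complex^'n) set" where
  "chart_range c \<equiv> chart_map c ` chart_dom c"

definition transition :: "('a, 'n) chart \<Rightarrow> ('a, 'n) chart \<Rightarrow> complex^'n \<Rightarrow> complex^'n" where
  "transition c d = chart_map d \<circ> inv_into (chart_dom c) (chart_map c)"

text \<open>The atlas need not be maximal, but it may be; the complex dimension is \<open>CARD('n)\<close>.\<close>

definition complex_manifold :: "'a topology \<Rightarrow> ('a, 'n::finite) chart set \<Rightarrow> bool" where
  "complex_manifold M A \<longleftrightarrow>
     Hausdorff_space M \<and> second_countable M \<and>
     topspace M = (\<Union>c\<in>A. chart_dom c) \<and>
     (\<forall>c\<in>A. openin M (chart_dom c) \<and> open (chart_range c) \<and>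
        homeomorphic_map (subtopology M (chart_dom c)) (top_of_set (chart_range c)) (chart_map c)) \<and>
     (\<forall>c\<in>A. \<forall>d\<in>A.
        holomorphic_map_on (chart_map c ` (chart_dom c \<inter> chart_dom d)) (transition c d))"


section \<open>The holomorphic tangent bundle\<close>

text \<open>
  A holomorphic tangent vector at \<open>p\<close> is represented by the family of its components
  \<open>v c = (\<eta>\<^sup>k)\<close> with respect to the frames \<open>\<partial>/\<partial>z\<^sup>k\<close> of all charts \<open>c\<close> around \<open>p\<close>; the components
  transform by the Jacobian of the coordinate change. The value at charts not containing \<open>p\<close>
  is fixed to 0, so that equality of tangent vectors is equality of functions.
\<close>

type_synonym ('a, 'n) tangent = "('a, 'n) chart \<Rightarrow> complex^'n"

definition hol_tangent_space :: "('a, 'n::finite) chart set \<Rightarrow> 'a \<Rightarrow> ('a, 'n) tangent set" where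
  "hol_tangent_space A p =
     {v. (\<forall>c. \<not> (c \<in> A \<and> p \<in> chart_dom c) \<longrightarrow> v c = 0) \<and>
         (\<forall>c\<in>A. \<forall>d\<in>A. p \<in> chart_dom c \<inter> chart_dom d \<longrightarrow>
            v d = frechet_derivative (transition c d) (at (chart_map c p)) (v c))}"

definition hol_tangent_bundle ::
    "'a topology \<Rightarrow> ('a, 'n::finite) chart set \<Rightarrow> ('a \<times> ('a, 'n) tangent) set" where
  "hol_tangent_bundle M A = Sigma (topspace M) (hol_tangent_space A)"

text \<open>The induced coordinates \<open>(z, \<eta>)\<close> on the part of \<open>T'M\<close> over the chart domain, with range
  \<open>chart_range c \<times> UNIV\<close>, and the local expression of a function on \<open>T'M\<close> in these coordinates.\<close>

definition bundle_coords ::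
    "('a, 'n) chart \<Rightarrow> 'a \<times> ('a, 'n) tangent \<Rightarrow> (complex^'n) \<times> (complex^'n)" where
  "bundle_coords c = (\<lambda>(p, v). (chart_map c p, v c))"

definition in_coords ::
    "'a topology \<Rightarrow> ('a, 'n::finite) chart set \<Rightarrow> ('a, 'n) chart \<Rightarrow> ('a \<times> ('a, 'n) tangent \<Rightarrow> 'b) \<Rightarrow>
     (complex^'n) \<times> (complex^'n) \<Rightarrow> 'b" where
  "in_coords M A c f =
     f \<circ> inv_into {x \<in> hol_tangent_bundle M A. fst x \<in> chart_dom c} (bundle_coords c)"


section \<open>Vertical calculus in local coordinates\<close>

text \<open>
  Below, \<open>F\<close> is the expression of a Finsler function in local coordinates \<open>x = (z, \<eta>)\<close>.
  \<open>dv k\<close> and \<open>dvbar k\<close> are the Wirtinger derivatives \<open>\<partial>/\<partial>\<eta>\<^sup>k\<close> and \<open>\<partial>/\<partial>\<eta>\<^sup>k\<close>-bar at fixed \<open>z\<close>;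
  \<open>axis k 1\<close> and \<open>axis k \<i>\<close> are the real and imaginary directions of the coordinate \<open>\<eta>\<^sup>k\<close>.
\<close>

type_synonym 'n coord_fun = "(complex^'n) \<times> (complex^'n) \<Rightarrow> complex"

definition dv :: "'n \<Rightarrow> 'n coord_fun \<Rightarrow> ('n::finite) coord_fun" where
  "dv k f = (\<lambda>(z, \<eta>). let D = frechet_derivative (\<lambda>w. f (z, w)) (at \<eta>)
                       in (D (axis k 1) - \<i> * D (axis k \<i>)) / 2)"

definition dvbar :: "'n \<Rightarrow> 'n coord_fun \<Rightarrow> ('n::finite) coord_fun" where
  "dvbar k f = (\<lambda>(z, \<eta>). let D = frechet_derivative (\<lambda>w. f (z, w)) (at \<eta>)
                          in (D (axis k 1) + \<i> * D (axis k \<i>)) / 2)"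

type_synonym 'n local_finsler = "(complex^'n) \<times> (complex^'n) \<Rightarrow> real"

text \<open>\<open>fund F i j\<close> is \<open>g\<close> with lower indices \<open>i\<close> and \<open>j\<close>-bar. Index bars are implicit in all names.\<close>

definition fund :: "'n local_finsler \<Rightarrow> 'n \<Rightarrow> 'n \<Rightarrow> ('n::finite) coord_fun" where
  "fund F i j = dv i (dvbar j (\<lambda>x. of_real ((F x)\<^sup>2)))"

definition fund_mat :: "'n local_finsler \<Rightarrow> (complex^'n) \<times> (complex^'n) \<Rightarrow> complex^'n^('n::finite)" where
  "fund_mat F x = (\<chi> i j. fund F i j x)"

definition pos_def_hermitian :: "complex^'n^('n::finite) \<Rightarrow> bool" where
  "pos_def_hermitian G \<longleftrightarrow>
     (\<forall>i j. G $ j $ i = cnj (G $ i $ j)) \<and>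
     (\<forall>\<xi>::complex^'n. \<xi> \<noteq> 0 \<longrightarrow> 0 < Re (\<Sum>i\<in>UNIV. \<Sum>j\<in>UNIV. G $ i $ j * \<xi> $ i * cnj (\<xi> $ j)))"

text \<open>\<open>fund_inv F m i\<close> has the upper indices \<open>m\<close>-bar and \<open>i\<close>.\<close>

definition fund_inv :: "'n local_finsler \<Rightarrow> 'n \<Rightarrow> 'n \<Rightarrow> ('n::finite) coord_fun" where
  "fund_inv F m i = (\<lambda>x. matrix_inv (fund_mat F x) $ m $ i)"

text \<open>\<open>CF F i j k\<close>: the vertical Chern-Finsler coefficient with upper index \<open>i\<close> and lower \<open>j k\<close>.\<close>

definition CF :: "'n local_finsler \<Rightarrow> 'n \<Rightarrow> 'n \<Rightarrow> 'n \<Rightarrow> ('n::finite) coord_fun" where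
  "CF F i j k = (\<lambda>x. \<Sum>l\<in>UNIV. fund_inv F l i x * dv k (fund F j l) x)"

text \<open>\<open>vv_curv F r j h k\<close>: indices \<open>r\<close>-bar, \<open>j\<close>, \<open>h\<close>-bar, \<open>k\<close>.\<close>

definition vv_curv :: "'n local_finsler \<Rightarrow> 'n \<Rightarrow> 'n \<Rightarrow> 'n \<Rightarrow> 'n \<Rightarrow> ('n::finite) coord_fun" where
  "vv_curv F r j h k = (\<lambda>x. - (\<Sum>i\<in>UNIV. fund F i r x * dvbar h (CF F i j k) x))"

text \<open>The vertical holomorphic sectional curvature in the direction with components \<open>X\<close>.\<close>

definition vert_sect_curv ::
    "'n local_finsler \<Rightarrow> ('n \<Rightarrow> 'n coord_fun) \<Rightarrow> ('n::finite) coord_fun" where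
  "vert_sect_curv F X = (\<lambda>x. 2 * (\<Sum>r\<in>UNIV. \<Sum>j\<in>UNIV. \<Sum>h\<in>UNIV. \<Sum>k\<in>UNIV.
     vv_curv F r j h k x * cnj (X r x) * X j x * cnj (X h x) * X k x))"


section \<open>Complex Finsler spaces\<close>

text \<open>Continuity on \<open>T'M\<close> and smoothness on the slit bundle are expressed in the bundle charts,
  which define the topology and the smooth structure of \<open>T'M\<close>.\<close>

definition complex_finsler_space ::
    "'a topology \<Rightarrow> ('a, 'n::finite) chart set \<Rightarrow> ('a \<times> ('a, 'n) tangent \<Rightarrow> real) \<Rightarrow> bool" where
  "complex_finsler_space M A F \<longleftrightarrow>
     complex_manifold M A \<and>
     (\<forall>x\<in>hol_tangent_bundle M A. 0 \<le> F x) \<and>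
     (\<forall>c\<in>A. continuous_on (chart_range c \<times> UNIV) (in_coords M A c F)) \<and>
     (\<forall>c\<in>A. smooth_on (chart_range c \<times> (UNIV - {0})) (in_coords M A c (\<lambda>x. (F x)\<^sup>2))) \<and>
     (\<forall>(p, v)\<in>hol_tangent_bundle M A. F (p, v) = 0 \<longleftrightarrow> v = (\<lambda>c. 0)) \<and>
     (\<forall>(p, v)\<in>hol_tangent_bundle M A. \<forall>\<mu>::complex. F (p, \<lambda>c. \<mu> *s v c) = cmod \<mu> * F (p, v)) \<and>
     (\<forall>c\<in>A. \<forall>z\<in>chart_range c. \<forall>\<eta>. \<eta> \<noteq> 0 \<longrightarrow>
        pos_def_hermitian (fund_mat (in_coords M A c F) (z, \<eta>)))"


section \<open>The vertical frame and the curvature invariant in dimension two\<close>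

definition l_up :: "2 local_finsler \<Rightarrow> 2 \<Rightarrow> 2 coord_fun" where
  "l_up F i = (\<lambda>(z, \<eta>). \<eta> $ i / of_real (F (z, \<eta>)))"

definition l_low :: "2 local_finsler \<Rightarrow> 2 \<Rightarrow> 2 coord_fun" where
  "l_low F i = (\<lambda>(z, \<eta>). 1 / of_real (F (z, \<eta>)) * (\<Sum>j\<in>UNIV. fund F i j (z, \<eta>) * cnj (\<eta> $ j)))"

text \<open>The determinant is a positive real on the slit tangent bundle, where the principal root
  \<open>csqrt\<close> is the usual positive one.\<close>

definition sqrt_g :: "2 local_finsler \<Rightarrow> 2 coord_fun" where
  "sqrt_g F = (\<lambda>x. csqrt (det (fund_mat F x)))"

definition m_up :: "2 local_finsler \<Rightarrow> 2 \<Rightarrow> 2 coord_fun" where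
  "m_up F i = (\<lambda>x. if i = 1 then - l_low F 2 x / sqrt_g F x else l_low F 1 x / sqrt_g F x)"

definition m_low :: "2 local_finsler \<Rightarrow> 2 \<Rightarrow> 2 coord_fun" where
  "m_low F i = (\<lambda>x. if i = 1 then - sqrt_g F x * l_up F 2 x else sqrt_g F x * l_up F 1 x)"

definition B_inv :: "2 local_finsler \<Rightarrow> 2 coord_fun" where
  "B_inv F = (\<lambda>x. \<Sum>h\<in>UNIV. \<Sum>k\<in>UNIV. \<Sum>j\<in>UNIV.
     m_low F h x * m_up F k x * m_up F j x * CF F h j k x)"

definition vert_curv_inv :: "2 local_finsler \<Rightarrow> 2 coord_fun" where
  "vert_curv_inv F = (\<lambda>x. - (\<Sum>s\<in>UNIV. dvbar s (B_inv F) x * cnj (m_up F s x))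
                           - 1 / 2 * B_inv F x * cnj (B_inv F x))"

text \<open>The derivative \<open>f|\<^sub>0\<close> along \<open>\<eta>\<close>.\<close>

definition dv0 :: "2 coord_fun \<Rightarrow> 2 coord_fun" where
  "dv0 f = (\<lambda>(z, \<eta>). \<Sum>k\<in>UNIV. \<eta> $ k * dv k f (z, \<eta>))"

end

theory Submission
  imports Defs
begin

text \<open>
  Everything happens in one fibre, where \<open>L = F\<^sup>2\<close> is homogeneous of bidegree \<open>(1, 1)\<close>; Euler's
  relations for \<open>L\<close> and its derivatives say which contractions with \<open>\<eta>\<close> vanish, and give (i).
  Up to the common factor \<open>E = \<surd>(L\<Delta>)\<close>, \<open>\<Delta> = det g\<close>, the vector \<open>m\<close> is \<open>N = (-L\<^sub>2, L\<^sub>1)\<close>, so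
  \<open>B = Q / E\<^sup>3\<close> where \<open>Q\<close> contracts the third derivatives of \<open>L\<close> with \<open>N, N\<close> and \<open>N\<close>-bar.
  Along \<open>N\<close>-bar the derivative of \<open>N\<close> is a multiple of \<open>\<eta>\<close>, that of \<open>N\<close>-bar a multiple of
  \<open>\<eta>\<close>-bar, and that of \<open>\<Delta>\<close> is \<open>Q\<close>-bar over \<open>L\<close>. Therefore both \<open>K\<^sub>m / 2\<close> and \<open>I\<close> are equal to
  \<open>(|Z|\<^sup>2 / L + |Q|\<^sup>2 / (L\<Delta>) - Y) / (L\<Delta>)\<^sup>2\<close>, with \<open>Z\<close> and \<open>Y\<close> contractions of second and
  fourth derivatives of \<open>L\<close>. This expression is visibly real and homogeneous of bidegree
  \<open>(-1, -1)\<close>, whence (iii).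
\<close>

section \<open>Smooth functions on open sets\<close>

text \<open>Since \<open>S\<close> is open, the derivatives at a point of \<open>S\<close> depend
  only on the values of the function on \<open>S\<close>.\<close>

lemma Ck_on_cong:
  assumes "open S" "Ck_on n S f" "\<And>x. x \<in> S \<Longrightarrow> f x = g x"
  shows "Ck_on n S g"
  using assms(2,3)
proof (induction n arbitrary: f g)
  case 0
  then show ?case by (simp cong: continuous_on_cong)
next
  case (Suc n)
  have diff: "f differentiable (at x)" "g differentiable (at x)" if "x \<in> S" for x
    using Suc.prems that assms(1) has_derivative_transform_within_open[of f _ x UNIV S g]
    by (auto simp: differentiable_def) blast
  moreover have "Ck_on n S (\<lambda>x. frechet_derivative g (at x) v)" for v
  proof (rule Suc.IH)
    show "Ck_on n S (\<lambda>x. frechet_derivative f (at x) v)"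
      using Suc.prems by simp
    show "frechet_derivative f (at x) v = frechet_derivative g (at x) v" if "x \<in> S" for x
      using frechet_derivative_transform_within_open[OF diff(1)[OF that] assms(1) that] Suc.prems(2)
      by metis
  qed
  ultimately show ?case by simp
qed

lemma Ck_on_bounded_linear:
  assumes "open S" "bounded_linear h" "Ck_on n S f"
  shows "Ck_on n S (\<lambda>x. h (f x))"
  using assms(3)
proof (induction n arbitrary: f)
  case 0
  then show ?case
    by (simp add: bounded_linear.continuous_on[OF assms(2)])
next
  case (Suc n)
  have D: "((\<lambda>x. h (f x)) has_derivative (\<lambda>v. h (frechet_derivative f (at x) v))) (at x)"
    if "x \<in> S" for x
    using Suc.prems that assms(2)
    by (auto intro: bounded_linear.has_derivative simp: frechet_derivative_works[symmetric])
  have "Ck_on n S (\<lambda>x. h (frechet_derivative f (at x) v))" for v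
    by (rule Suc.IH) (use Suc.prems in simp)
  then have "Ck_on n S (\<lambda>x. frechet_derivative (\<lambda>x. h (f x)) (at x) v)" for v
    by (rule Ck_on_cong[OF assms(1)]) (simp add: frechet_derivative_at[OF D, symmetric])
  then show ?case
    using D by (auto simp: differentiable_def)
qed

lemma Ck_on_add:
  assumes "open S" "Ck_on n S f" "Ck_on n S g"
  shows "Ck_on n S (\<lambda>x. f x + g x)"
  using assms(2,3)
proof (induction n arbitrary: f g)
  case 0
  then show ?case by (simp add: continuous_on_add)
next
  case (Suc n)
  have D: "((\<lambda>x. f x + g x) has_derivative
      (\<lambda>v. frechet_derivative f (at x) v + frechet_derivative g (at x) v)) (at x)"
    if "x \<in> S" for x
    using Suc.prems that
    by (auto intro!: has_derivative_add simp: frechet_derivative_works[symmetric])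
  have "Ck_on n S (\<lambda>x. frechet_derivative f (at x) v + frechet_derivative g (at x) v)" for v
    by (rule Suc.IH) (use Suc.prems in simp_all)
  then have "Ck_on n S (\<lambda>x. frechet_derivative (\<lambda>x. f x + g x) (at x) v)" for v
    by (rule Ck_on_cong[OF assms(1)]) (simp add: frechet_derivative_at[OF D, symmetric])
  then show ?case
    using D by (auto simp: differentiable_def)
qed

text \<open>Restricts smoothness in all bundle coordinates to one fibre: the derivative of the slice
  in direction v is the total derivative in direction (0, v).\<close>

lemma Ck_on_slice:
  fixes f :: "'a::real_normed_vector \<times> 'b::real_normed_vector \<Rightarrow> 'c::real_normed_vector"
  assumes "open S" "Ck_on n (R \<times> S) f" "z \<in> R"
  shows "Ck_on n S (\<lambda>w. f (z, w))"
  using assms(2)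
proof (induction n arbitrary: f)
  case 0
  then have "continuous_on (Pair z ` S) f"
    using assms(3) by (auto intro: continuous_on_subset)
  then show ?case
    using continuous_on_compose2[of "Pair z ` S" f S "Pair z"]
    by (simp add: continuous_on_Pair)
next
  case (Suc n)
  have D: "((\<lambda>w. f (z, w)) has_derivative (\<lambda>v. frechet_derivative f (at (z, w)) (0, v))) (at w)"
    if "w \<in> S" for w
  proof -
    have f: "(f has_derivative frechet_derivative f (at (z, w))) (at (z, w))"
      using Suc.prems that assms(3) by (simp add: frechet_derivative_works[symmetric])
    have "(Pair z has_derivative (\<lambda>v. (0, v))) (at w)"
      by (intro has_derivative_Pair has_derivative_const has_derivative_ident)
    from diff_chain_at[OF this f] show ?thesis
      by (simp add: o_def)
  qed
  have "Ck_on n S (\<lambda>w. frechet_derivative f (at (z, w)) (0, v))" for v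
    by (rule Suc.IH) (use Suc.prems in simp)
  then have "Ck_on n S (\<lambda>w. frechet_derivative (\<lambda>w. f (z, w)) (at w) v)" for v
    by (rule Ck_on_cong[OF assms(1)]) (simp add: frechet_derivative_at[OF D, symmetric])
  then show ?case
    using D by (auto simp: differentiable_def)
qed

lemma Ck_on_two:
  "Ck_on (Suc (Suc 0)) S f \<longleftrightarrow> (\<forall>x\<in>S. f differentiable (at x)) \<and>
     (\<forall>v. \<forall>x\<in>S. (\<lambda>x. frechet_derivative f (at x) v) differentiable (at x)) \<and>
     (\<forall>v u. continuous_on S (\<lambda>x. frechet_derivative (\<lambda>x. frechet_derivative f (at x) v) (at x) u))"
  by auto

section \<open>Symmetry of second derivatives\<close>

lemma has_vector_derivative_along_line:
  assumes "f differentiable (at (x + t *\<^sub>R u))"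
  shows "((\<lambda>t. f (x + t *\<^sub>R u)) has_vector_derivative frechet_derivative f (at (x + t *\<^sub>R u)) u) (at t)"
proof -
  have D: "(f has_derivative frechet_derivative f (at (x + t *\<^sub>R u))) (at (x + t *\<^sub>R u))"
    using assms frechet_derivative_works by blast
  have "((\<lambda>t. x + t *\<^sub>R u) has_derivative (\<lambda>s. s *\<^sub>R u)) (at t)"
    by (auto intro!: derivative_eq_intros)
  from diff_chain_at[OF this D] show ?thesis
    by (simp add: o_def has_vector_derivative_def linear_cmul linear_frechet_derivative[OF assms])
qed

text \<open>The mean value theorem is applied twice: in direction u to the difference of
  \<open>f\<close> over the step t v, then in direction v to the derivative along u. The left-hand
  side is symmetric in u and v, which is what the symmetry proof exploits.\<close>

lemma second_difference_mean_value:
  fixes f :: "'a::real_normed_vector \<Rightarrow> real"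
  assumes "Ck_on (Suc (Suc 0)) S f" "0 < t"
    and box: "\<And>s r. \<lbrakk>0 \<le> s; s \<le> t; 0 \<le> r; r \<le> t\<rbrakk> \<Longrightarrow> x + s *\<^sub>R u + r *\<^sub>R v \<in> S"
  obtains s r where "0 < s" "s < t" "0 < r" "r < t"
    "f (x + t *\<^sub>R u + t *\<^sub>R v) - f (x + t *\<^sub>R u) - f (x + t *\<^sub>R v) + f x
      = t\<^sup>2 * frechet_derivative (\<lambda>x. frechet_derivative f (at x) u) (at (x + s *\<^sub>R u + r *\<^sub>R v)) v"
proof -
  define Du where "Du = (\<lambda>x. frechet_derivative f (at x) u)"
  have f: "f differentiable (at y)" and Du: "Du differentiable (at y)" if "y \<in> S" for y
    using assms(1) that unfolding Ck_on_two Du_def by auto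
  define \<phi> where "\<phi> s = f (x + t *\<^sub>R v + s *\<^sub>R u) - f (x + s *\<^sub>R u)" for s
  have "DERIV \<phi> s :> Du (x + t *\<^sub>R v + s *\<^sub>R u) - Du (x + s *\<^sub>R u)" if "0 \<le> s" "s \<le> t" for s
    unfolding \<phi>_def Du_def has_real_derivative_iff_has_vector_derivative
    using box[of s t] box[of s 0] that assms(2)
    by (intro has_vector_derivative_diff has_vector_derivative_along_line f) (auto simp: algebra_simps)
  from MVT2[OF assms(2) this] obtain s where s: "0 < s" "s < t"
    "\<phi> t - \<phi> 0 = t * (Du (x + t *\<^sub>R v + s *\<^sub>R u) - Du (x + s *\<^sub>R u))"
    by auto
  have "DERIV (\<lambda>r. Du (x + s *\<^sub>R u + r *\<^sub>R v)) r :> frechet_derivative Du (at (x + s *\<^sub>R u + r *\<^sub>R v)) v"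
    if "0 \<le> r" "r \<le> t" for r
    unfolding has_real_derivative_iff_has_vector_derivative
    using box[of s r] that s by (intro has_vector_derivative_along_line Du) auto
  from MVT2[OF assms(2) this] obtain r where r: "0 < r" "r < t"
    "Du (x + s *\<^sub>R u + t *\<^sub>R v) - Du (x + s *\<^sub>R u)
      = t * frechet_derivative Du (at (x + s *\<^sub>R u + r *\<^sub>R v)) v"
    by auto
  have "\<phi> t - \<phi> 0 = t\<^sup>2 * frechet_derivative Du (at (x + s *\<^sub>R u + r *\<^sub>R v)) v"
    using s(3) r(3) by (simp add: power2_eq_square algebra_simps)
  then show ?thesis
    using that[OF s(1,2) r(1,2)] by (simp add: Du_def \<phi>_def algebra_simps)
qed

text \<open>Both mixed derivatives, at points arbitrarily near x, equal the same second difference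
  divided by the square of t; their continuity at x then forces equality there.\<close>

lemma symmetric_second_derivative_real:
  fixes f :: "'a::real_normed_vector \<Rightarrow> real"
  assumes "open S" "Ck_on (Suc (Suc 0)) S f" "x \<in> S"
  shows "frechet_derivative (\<lambda>x. frechet_derivative f (at x) u) (at x) v
       = frechet_derivative (\<lambda>x. frechet_derivative f (at x) v) (at x) u"
proof -
  define P where "P = (\<lambda>y. frechet_derivative (\<lambda>x. frechet_derivative f (at x) u) (at y) v)"
  define Q where "Q = (\<lambda>y. frechet_derivative (\<lambda>x. frechet_derivative f (at x) v) (at y) u)"
  have "continuous_on S P" "continuous_on S Q"
    using assms(2) by (simp_all add: P_def Q_def)
  then have "isCont P x" "isCont Q x"
    using assms(1,3) by (simp_all add: continuous_on_eq_continuous_at)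
  have "dist (P x) (Q x) < 2 * \<epsilon>" if "\<epsilon> > 0" for \<epsilon>
  proof -
    obtain d1 where d1: "d1 > 0" "\<And>y. dist y x < d1 \<Longrightarrow> dist (P y) (P x) < \<epsilon>"
      using iffD1[OF continuous_at_eps_delta \<open>isCont P x\<close>, rule_format, OF \<open>\<epsilon> > 0\<close>] by auto
    obtain d2 where d2: "d2 > 0" "\<And>y. dist y x < d2 \<Longrightarrow> dist (Q y) (Q x) < \<epsilon>"
      using iffD1[OF continuous_at_eps_delta \<open>isCont Q x\<close>, rule_format, OF \<open>\<epsilon> > 0\<close>] by auto
    obtain d3 where d3: "d3 > 0" "ball x d3 \<subseteq> S"
      using assms(1,3) open_contains_ball by blast
    define d where "d = min d1 (min d2 d3)"
    \<comment> \<open>As t m = d / 2, the parallelogram spanned by t u and t v at x stays within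
      distance d of x. The summand 1 keeps \<open>m\<close> positive when u = v = 0.\<close>
    define m where "m = norm u + norm v + 1"
    define t where "t = d / (2 * m)"
    have m: "m > 0"
      unfolding m_def by (intro add_nonneg_pos add_nonneg_nonneg norm_ge_zero zero_less_one)
    have d: "d > 0" using d1 d2 d3 by (simp add: d_def)
    then have t: "t > 0" using m by (simp add: t_def)
    have near: "dist (x + s *\<^sub>R u + r *\<^sub>R v) x < d" if "0 \<le> s" "s \<le> t" "0 \<le> r" "r \<le> t" for s r
    proof -
      have "norm (s *\<^sub>R u + r *\<^sub>R v) \<le> s * norm u + r * norm v"
        using that norm_triangle_ineq[of "s *\<^sub>R u" "r *\<^sub>R v"] by simp
      also have "\<dots> \<le> t * norm u + t * norm v"
        using that by (intro add_mono mult_right_mono) simp_all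
      also have "\<dots> \<le> t * m"
        using t by (simp add: m_def algebra_simps)
      also have "\<dots> < d"
        using d m by (simp add: t_def)
      finally show ?thesis by (simp add: dist_norm add.assoc)
    qed
    have box: "x + s *\<^sub>R u + r *\<^sub>R v \<in> S" if "0 \<le> s" "s \<le> t" "0 \<le> r" "r \<le> t" for s r
      using near[OF that] d3 by (simp add: d_def dist_commute subset_iff)
    have box': "x + r *\<^sub>R v + s *\<^sub>R u \<in> S" if "0 \<le> s" "s \<le> t" "0 \<le> r" "r \<le> t" for s r
      using box[OF that] by (metis add.assoc add.commute)
    obtain s r where sr: "0 < s" "s < t" "0 < r" "r < t"
      "f (x + t *\<^sub>R u + t *\<^sub>R v) - f (x + t *\<^sub>R u) - f (x + t *\<^sub>R v) + f x
        = t\<^sup>2 * P (x + s *\<^sub>R u + r *\<^sub>R v)"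
      by (rule second_difference_mean_value[OF assms(2) t, of x u v]) (use box P_def in auto)+
    obtain s' r' where sr': "0 < s'" "s' < t" "0 < r'" "r' < t"
      "f (x + t *\<^sub>R v + t *\<^sub>R u) - f (x + t *\<^sub>R v) - f (x + t *\<^sub>R u) + f x
        = t\<^sup>2 * Q (x + s' *\<^sub>R v + r' *\<^sub>R u)"
      by (rule second_difference_mean_value[OF assms(2) t, of x v u]) (use box' Q_def in auto)+
    have "t\<^sup>2 * P (x + s *\<^sub>R u + r *\<^sub>R v) = t\<^sup>2 * Q (x + s' *\<^sub>R v + r' *\<^sub>R u)"
      using sr(5) sr'(5) by (simp add: algebra_simps)
    then have "P (x + s *\<^sub>R u + r *\<^sub>R v) = Q (x + s' *\<^sub>R v + r' *\<^sub>R u)"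
      using t by simp
    moreover have "dist (P (x + s *\<^sub>R u + r *\<^sub>R v)) (P x) < \<epsilon>"
      using near[of s r] sr by (intro d1) (auto simp: d_def)
    moreover have "dist (Q (x + s' *\<^sub>R v + r' *\<^sub>R u)) (Q x) < \<epsilon>"
      using near[of r' s'] sr' by (intro d2) (auto simp: d_def algebra_simps)
    ultimately show ?thesis
      by (simp add: dist_real_def)
  qed
  \<comment> \<open>A positive distance would here be smaller than itself.\<close>
  from this[of "dist (P x) (Q x) / 2"] have "P x = Q x"
    by auto
  then show ?thesis by (simp add: P_def Q_def)
qed

text \<open>Reduces to real functions: taking the component along a basis vector b is bounded linear
  and so commutes with differentiation.\<close>

lemma symmetric_second_derivative:
  fixes f :: "'a::real_normed_vector \<Rightarrow> 'b::euclidean_space"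
  assumes "open S" "Ck_on (Suc (Suc 0)) S f" "x \<in> S"
  shows "frechet_derivative (\<lambda>x. frechet_derivative f (at x) u) (at x) v
       = frechet_derivative (\<lambda>x. frechet_derivative f (at x) v) (at x) u"
proof (rule euclidean_eqI)
  fix b :: 'b
  have f: "f differentiable (at y)" "(\<lambda>x. frechet_derivative f (at x) u) differentiable (at y)"
    if "y \<in> S" for y u
    using assms(2) that unfolding Ck_on_two by auto
  have inner: "frechet_derivative (\<lambda>x. h x \<bullet> b) (at y) w = frechet_derivative h (at y) w \<bullet> b"
    if "h differentiable (at y)" for h :: "'a \<Rightarrow> 'b" and y w
    using frechet_derivative_at[OF has_derivative_inner_left[OF that[unfolded frechet_derivative_works]], of b]
    by (simp add: fun_eq_iff)
  have *: "frechet_derivative (\<lambda>x. frechet_derivative (\<lambda>x. f x \<bullet> b) (at x) u) (at x) v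
      = frechet_derivative (\<lambda>x. frechet_derivative f (at x) u) (at x) v \<bullet> b" for u v
  proof -
    have "frechet_derivative (\<lambda>x. frechet_derivative f (at x) u \<bullet> b) (at x)
       = frechet_derivative (\<lambda>x. frechet_derivative (\<lambda>x. f x \<bullet> b) (at x) u) (at x)"
      using f assms(1,3) by (intro frechet_derivative_transform_within_open[where X=S])
        (auto simp: inner intro!: differentiable_inner)
    then show ?thesis
      by (simp add: inner[OF f(2)[OF assms(3)], symmetric])
  qed
  show "frechet_derivative (\<lambda>x. frechet_derivative f (at x) u) (at x) v \<bullet> b
     = frechet_derivative (\<lambda>x. frechet_derivative f (at x) v) (at x) u \<bullet> b"
    using symmetric_second_derivative_real[OF assms(1) Ck_on_bounded_linear[OF assms(1) bounded_linear_inner_left assms(2)] assms(3), of b u v]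
    unfolding * .
qed

section \<open>Wirtinger derivatives\<close>

text \<open>For \<open>\<sigma> = 1\<close> this is the derivative in the \<open>k\<close>-th variable, for \<open>\<sigma> = -1\<close> the one in its
  conjugate; the calculus rules do not depend on the value of \<open>\<sigma>\<close>.\<close>

definition wirt ::
    "complex \<Rightarrow> 'n::finite \<Rightarrow> (complex^'n \<Rightarrow> complex) \<Rightarrow> complex^'n \<Rightarrow> complex" where
  "wirt \<sigma> k f w = (frechet_derivative f (at w) (axis k 1)
                    - \<sigma> * \<i> * frechet_derivative f (at w) (axis k \<i>)) / 2"

lemma wirt_eqI:
  assumes "(f has_derivative D) (at w)"
  shows "wirt \<sigma> k f w = (D (axis k 1) - \<sigma> * \<i> * D (axis k \<i>)) / 2"
  by (simp add: wirt_def frechet_derivative_at[OF assms, symmetric])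

lemma wirt_cong:
  assumes "open S" "w \<in> S" "f differentiable (at w)" "\<And>x. x \<in> S \<Longrightarrow> f x = g x"
  shows "wirt \<sigma> k f w = wirt \<sigma> k g w"
  unfolding wirt_def
  using frechet_derivative_transform_within_open[OF assms(3,1,2,4)] by simp

lemma wirt_const [simp]: "wirt \<sigma> k (\<lambda>w. c) w = 0"
  by (simp add: wirt_def)

lemma wirt_add:
  assumes "f differentiable (at w)" "g differentiable (at w)"
  shows "wirt \<sigma> k (\<lambda>w. f w + g w) w = wirt \<sigma> k f w + wirt \<sigma> k g w"
  using assms unfolding frechet_derivative_works
  by (subst wirt_eqI[OF has_derivative_add]) (auto simp: wirt_def algebra_simps add_divide_distrib diff_divide_distrib)

lemma wirt_diff:
  assumes "f differentiable (at w)" "g differentiable (at w)"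
  shows "wirt \<sigma> k (\<lambda>w. f w - g w) w = wirt \<sigma> k f w - wirt \<sigma> k g w"
  using assms unfolding frechet_derivative_works
  by (subst wirt_eqI[OF has_derivative_diff]) (auto simp: wirt_def algebra_simps add_divide_distrib diff_divide_distrib)

lemma wirt_minus:
  assumes "f differentiable (at w)"
  shows "wirt \<sigma> k (\<lambda>w. - f w) w = - wirt \<sigma> k f w"
  using wirt_diff[OF differentiable_const[of 0] assms] by simp

lemma wirt_mult:
  assumes "f differentiable (at w)" "g differentiable (at w)"
  shows "wirt \<sigma> k (\<lambda>w. f w * g w) w = wirt \<sigma> k f w * g w + f w * wirt \<sigma> k g w"
  using assms unfolding frechet_derivative_works
  by (subst wirt_eqI[OF has_derivative_mult])
    (auto simp: wirt_def algebra_simps add_divide_distrib diff_divide_distrib)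

text \<open>The outer function is holomorphic, so only its complex derivative enters, for either
  kind of Wirtinger derivative. It serves for the square root and the inverse cube in the
  normalisation of the frame.\<close>

lemma wirt_chain:
  assumes "f differentiable (at w)" "(\<phi> has_field_derivative \<phi>') (at (f w))"
  shows "(\<lambda>w. \<phi> (f w)) differentiable (at w)"
    and "wirt \<sigma> k (\<lambda>w. \<phi> (f w)) w = \<phi>' * wirt \<sigma> k f w"
proof -
  have D: "((\<lambda>w. \<phi> (f w)) has_derivative (\<lambda>v. \<phi>' * frechet_derivative f (at w) v)) (at w)"
    using diff_chain_at[of f _ w \<phi> "(*) \<phi>'"] assms
    by (simp add: o_def has_field_derivative_def frechet_derivative_works)
  then show "(\<lambda>w. \<phi> (f w)) differentiable (at w)"
    using differentiableI by blast
  show "wirt \<sigma> k (\<lambda>w. \<phi> (f w)) w = \<phi>' * wirt \<sigma> k f w"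
    unfolding wirt_eqI[OF D] by (simp add: wirt_def algebra_simps diff_divide_distrib)
qed

text \<open>Conjugation replaces the coefficient of the imaginary direction by its conjugate; for
  \<sigma> = 1 and \<sigma> = -1 this exchanges the two Wirtinger derivatives.\<close>

lemma wirt_cnj:
  assumes "f differentiable (at w)"
  shows "(\<lambda>w. cnj (f w)) differentiable (at w)"
    and "wirt \<sigma> k (\<lambda>w. cnj (f w)) w = cnj (wirt (- cnj \<sigma>) k f w)"
proof -
  have D: "((\<lambda>w. cnj (f w)) has_derivative (\<lambda>v. cnj (frechet_derivative f (at w) v))) (at w)"
    using assms by (intro has_derivative_cnj) (simp add: frechet_derivative_works)
  then show "(\<lambda>w. cnj (f w)) differentiable (at w)"
    using differentiableI by blast
  show "wirt \<sigma> k (\<lambda>w. cnj (f w)) w = cnj (wirt (- cnj \<sigma>) k f w)"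
    unfolding wirt_eqI[OF D] by (simp add: wirt_def algebra_simps diff_divide_distrib)
qed

lemma smooth_on_of_real:
  assumes "open S" "smooth_on S f"
  shows "smooth_on S (\<lambda>w. of_real (f w) :: complex)"
  using assms(2) Ck_on_bounded_linear[OF assms(1) bounded_linear_of_real] unfolding smooth_on_def by blast

lemma smooth_on_differentiable:
  assumes "smooth_on S f" "w \<in> S"
  shows "f differentiable (at w)"
  using assms Ck_on.simps(2)[of 0 S f] unfolding smooth_on_def by blast

lemma smooth_on_wirt:
  assumes "open S" "smooth_on S f"
  shows "smooth_on S (wirt \<sigma> k f)"
  unfolding smooth_on_def
proof
  fix n
  have D: "Ck_on n S (\<lambda>w. frechet_derivative f (at w) v)" for v
    using assms(2) Ck_on.simps(2)[of n S f] unfolding smooth_on_def by blast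
  have "Ck_on n S (\<lambda>w. frechet_derivative f (at w) (axis k 1) * (1 / 2)
      + frechet_derivative f (at w) (axis k \<i>) * (- \<sigma> * \<i> / 2))"
    by (intro Ck_on_add assms(1) Ck_on_bounded_linear[OF assms(1) bounded_linear_mult_left] D)
  then show "Ck_on n S (wirt \<sigma> k f)"
    by (rule Ck_on_cong[OF assms(1)]) (simp add: wirt_def field_simps)
qed

text \<open>Both sides expand into the same four second derivatives along real and imaginary
  coordinate directions, up to the order of differentiation.\<close>

lemma wirt_commute:
  assumes "open S" "smooth_on S f" "w \<in> S"
  shows "wirt \<sigma> j (wirt \<tau> k f) w = wirt \<tau> k (wirt \<sigma> j f) w"
proof -
  have f: "Ck_on (Suc (Suc 0)) S f"
    using assms(2) by (simp add: smooth_on_def)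
  define D where "D u v = frechet_derivative (\<lambda>x. frechet_derivative f (at x) u) (at w) v" for u v
  have second: "wirt \<sigma> j (wirt \<tau> k f) w
      = ((D (axis k 1) (axis j 1) - \<tau> * \<i> * D (axis k \<i>) (axis j 1))
        - \<sigma> * \<i> * (D (axis k 1) (axis j \<i>) - \<tau> * \<i> * D (axis k \<i>) (axis j \<i>))) / 4"
    for \<sigma> \<tau> j k
  proof -
    have "((\<lambda>x. frechet_derivative f (at x) u) has_derivative D u) (at w)" for u
      using f assms(3) unfolding D_def Ck_on_two by (simp add: frechet_derivative_works)
    then have "((\<lambda>x. (frechet_derivative f (at x) (axis k 1)
        - \<tau> * \<i> * frechet_derivative f (at x) (axis k \<i>)) / 2) has_derivative
      (\<lambda>v. (D (axis k 1) v - \<tau> * \<i> * D (axis k \<i>) v) / 2)) (at w)"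
      by (intro bounded_linear.has_derivative[OF bounded_linear_divide] has_derivative_diff has_derivative_mult_right)
    then have "(wirt \<tau> k f has_derivative
      (\<lambda>v. (D (axis k 1) v - \<tau> * \<i> * D (axis k \<i>) v) / 2)) (at w)"
      by (simp add: wirt_def[abs_def])
    then show ?thesis
      by (simp add: wirt_eqI diff_divide_distrib algebra_simps)
  qed
  have "D u v = D v u" for u v
    unfolding D_def by (rule symmetric_second_derivative[OF assms(1) f assms(3)])
  then show ?thesis
    unfolding second by (simp add: algebra_simps)
qed

section \<open>Functions homogeneous of bidegree \<open>(p, q)\<close>\<close>

text \<open>Degrees are integers because repeated differentiation makes them negative; this is why
  the origin and the factor 0 are excluded.\<close>

definition bihom :: "int \<Rightarrow> int \<Rightarrow> (complex^'n::finite \<Rightarrow> complex) \<Rightarrow> bool" where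
  "bihom p q f \<longleftrightarrow>
     (\<forall>\<mu> w. \<mu> \<noteq> 0 \<longrightarrow> w \<noteq> 0 \<longrightarrow> f (\<mu> *s w) = \<mu> powi p * cnj \<mu> powi q * f w)"

lemma bihom_mult:
  assumes "bihom p q f" "bihom p' q' g"
  shows "bihom (p + p') (q + q') (\<lambda>w. f w * g w)"
  using assms by (simp add: bihom_def power_int_add)

lemma bihom_add:
  assumes "bihom p q f" "bihom p q g"
  shows "bihom p q (\<lambda>w. f w + g w)"
  using assms by (simp add: bihom_def algebra_simps)

lemma bihom_minus:
  assumes "bihom p q f"
  shows "bihom p q (\<lambda>w. - f w)"
  using assms by (simp add: bihom_def)

lemma bihom_diff:
  assumes "bihom p q f" "bihom p q g"
  shows "bihom p q (\<lambda>w. f w - g w)"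
  using assms by (simp add: bihom_def algebra_simps)

lemma bihom_cnj:
  assumes "bihom p q f"
  shows "bihom q p (\<lambda>w. cnj (f w))"
  using assms by (simp add: bihom_def)

lemma bihom_inverse:
  assumes "bihom p q f"
  shows "bihom (- p) (- q) (\<lambda>w. inverse (f w))"
  using assms by (simp add: bihom_def power_int_minus)

lemma smult_eq_zero_iff: "(\<mu>::complex) *s w = 0 \<longleftrightarrow> \<mu> = 0 \<or> w = 0"
  by (auto simp: vec_eq_iff)

text \<open>Frechet derivatives are only real linear, so a complex multiple of a coordinate vector
  splits into its real and imaginary directions.\<close>

lemma linear_axis:
  assumes "linear (D :: complex^'n::finite \<Rightarrow> complex)"
  shows "D (axis k \<mu>) = of_real (Re \<mu>) * D (axis k 1) + of_real (Im \<mu>) * D (axis k \<i>)"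
proof -
  have "axis k \<mu> = Re \<mu> *\<^sub>R axis k 1 + Im \<mu> *\<^sub>R (axis k \<i> :: complex^'n)"
    by (simp add: vec_eq_iff axis_def complex_eq_iff)
  then have "D (axis k \<mu>) = Re \<mu> *\<^sub>R D (axis k 1) + Im \<mu> *\<^sub>R D (axis k \<i>)"
    by (simp only: linear_add[OF assms] linear_cmul[OF assms])
  then show ?thesis
    by (simp add: scaleR_conv_of_real)
qed

lemma has_derivative_smult_left:
  "((\<lambda>\<mu>::complex. \<mu> *s w) has_derivative (\<lambda>\<nu>. \<nu> *s w)) F"
proof -
  have "bounded_linear (\<lambda>\<mu>::complex. \<mu> *s w)"
    by (intro linear_conv_bounded_linear[THEN iffD1] linearI) (auto simp: vec_eq_iff algebra_simps)
  then show ?thesis by (rule bounded_linear_imp_has_derivative)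
qed

lemma has_derivative_smult_right:
  "((\<lambda>w. (\<mu>::complex) *s w) has_derivative (\<lambda>v. \<mu> *s v)) F"
proof -
  have "bounded_linear (\<lambda>w. \<mu> *s w)"
    by (intro linear_conv_bounded_linear[THEN iffD1] linearI) (auto simp: vec_eq_iff algebra_simps)
  then show ?thesis by (rule bounded_linear_imp_has_derivative)
qed

text \<open>Differentiate f (\<mu> w) = c f w in w. Multiplication by \<mu> mixes the directions 1
  and i of the k-th coordinate by a real 2 x 2 matrix; the two Wirtinger combinations diagonalise
  it, with factors \<mu> and its conjugate, and dividing by that factor lowers one degree.\<close>

lemma bihom_wirt:
  assumes "bihom p q f" and diff: "\<And>w. w \<noteq> 0 \<Longrightarrow> f differentiable (at w)"
  shows "bihom (p - 1) q (wirt 1 k f)" and "bihom p (q - 1) (wirt (-1) k f)"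
proof -
  have "wirt 1 k f (\<mu> *s w) = \<mu> powi (p - 1) * cnj \<mu> powi q * wirt 1 k f w
      \<and> wirt (-1) k f (\<mu> *s w) = \<mu> powi p * cnj \<mu> powi (q - 1) * wirt (-1) k f w"
    if "\<mu> \<noteq> 0" "w \<noteq> 0" for \<mu> w
  proof -
    define c where "c = \<mu> powi p * cnj \<mu> powi q"
    define D where "D = frechet_derivative f (at w)"
    define P where "P = frechet_derivative f (at (\<mu> *s w))"
    have D: "(f has_derivative D) (at w)" and P: "(f has_derivative P) (at (\<mu> *s w))"
      using diff[of w] diff[of "\<mu> *s w"] that
      by (simp_all add: D_def P_def frechet_derivative_works smult_eq_zero_iff)
    have "((\<lambda>w. f (\<mu> *s w)) has_derivative (\<lambda>v. P (\<mu> *s v))) (at w)"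
      using diff_chain_at[OF has_derivative_smult_right P] by (simp add: o_def)
    moreover have "((\<lambda>w. f (\<mu> *s w)) has_derivative (\<lambda>v. c * D v)) (at w)"
      by (rule has_derivative_transform_within_open[OF has_derivative_mult_right[OF D], of "- {0}"])
        (use assms(1) that in \<open>auto simp: bihom_def c_def\<close>)
    ultimately have PD: "P (\<mu> *s v) = c * D v" for v
      using has_derivative_unique by metis
    have smult_axis: "\<mu> *s axis k a = axis k (\<mu> * a)" for a
      by (simp add: vec_eq_iff axis_def)
    note lin = linear_axis[OF has_derivative_linear[OF P]]
    have 1: "Re \<mu> * P (axis k 1) + Im \<mu> * P (axis k \<i>) = c * D (axis k 1)"
      using PD[of "axis k 1"] lin[of k \<mu>] by (simp add: smult_axis)
    have 2: "- Im \<mu> * P (axis k 1) + Re \<mu> * P (axis k \<i>) = c * D (axis k \<i>)"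
      using PD[of "axis k \<i>"] lin[of k "\<mu> * \<i>"] by (simp add: smult_axis)
    have mu: "\<mu> = Re \<mu> + \<i> * Im \<mu>" "cnj \<mu> = Re \<mu> - \<i> * Im \<mu>"
      by (simp_all add: complex_eq_iff)
    have "\<mu> * (P (axis k 1) - \<i> * P (axis k \<i>))
        = (Re \<mu> * P (axis k 1) + Im \<mu> * P (axis k \<i>)) - \<i> * (- Im \<mu> * P (axis k 1) + Re \<mu> * P (axis k \<i>))"
      by (subst mu(1)) (simp add: algebra_simps)
    then have "\<mu> * (P (axis k 1) - \<i> * P (axis k \<i>)) = c * (D (axis k 1) - \<i> * D (axis k \<i>))"
      unfolding 1 2 by (simp add: algebra_simps)
    then have A: "\<mu> * wirt 1 k f (\<mu> *s w) = c * wirt 1 k f w"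
      by (simp add: wirt_eqI[OF P] wirt_eqI[OF D])
    have "cnj \<mu> * (P (axis k 1) + \<i> * P (axis k \<i>))
        = (Re \<mu> * P (axis k 1) + Im \<mu> * P (axis k \<i>)) + \<i> * (- Im \<mu> * P (axis k 1) + Re \<mu> * P (axis k \<i>))"
      by (subst mu(2)) (simp add: algebra_simps)
    then have "cnj \<mu> * (P (axis k 1) + \<i> * P (axis k \<i>)) = c * (D (axis k 1) + \<i> * D (axis k \<i>))"
      unfolding 1 2 by (simp add: algebra_simps)
    then have B: "cnj \<mu> * wirt (-1) k f (\<mu> *s w) = c * wirt (-1) k f w"
      by (simp add: wirt_eqI[OF P] wirt_eqI[OF D])
    from A B that show ?thesis
      by (simp add: c_def power_int_diff nonzero_eq_divide_eq mult_ac)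
  qed
  then show "bihom (p - 1) q (wirt 1 k f)" "bihom p (q - 1) (wirt (-1) k f)"
    by (simp_all add: bihom_def)
qed

text \<open>Differentiate f (\<mu> w) in \<mu> at 1 in two ways: by the chain rule and by the
  homogeneity formula.\<close>

lemma euler:
  fixes f :: "complex^'n::finite \<Rightarrow> complex"
  assumes "bihom p q f" "f differentiable (at w)" "w \<noteq> 0"
  shows "(\<Sum>k\<in>UNIV. w $ k * wirt 1 k f w) = of_int p * f w"
    and "(\<Sum>k\<in>UNIV. cnj (w $ k) * wirt (-1) k f w) = of_int q * f w"
proof -
  define D where "D = frechet_derivative f (at w)"
  have D: "(f has_derivative D) (at w)"
    using assms(2) by (simp add: D_def frechet_derivative_works)
  have "((\<lambda>\<mu>. f (\<mu> *s w)) has_derivative (\<lambda>\<nu>. D (\<nu> *s w))) (at 1)"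
    using diff_chain_at[OF has_derivative_smult_left[of w "at 1"], of f D] D by (simp add: o_def)
  moreover have "((\<lambda>\<mu>. f (\<mu> *s w)) has_derivative (\<lambda>\<nu>. (of_int p * \<nu> + of_int q * cnj \<nu>) * f w)) (at 1)"
  proof (rule has_derivative_transform_within_open[of _ _ _ _ "- {0}"])
    have pw: "((\<lambda>\<mu>::complex. \<mu> powi p) has_derivative (\<lambda>\<nu>. of_int p * \<nu>)) (at 1)" for p
      using DERIV_power_int[OF DERIV_ident, where s=UNIV and x="1::complex" and n=p] by (simp add: has_field_derivative_def)
    have "((\<lambda>\<mu>. cnj \<mu> powi q) has_derivative (\<lambda>\<nu>. cnj (of_int q * \<nu>))) (at 1)"
      using has_derivative_cnj[OF pw[of q]] by simp
    note * = has_derivative_mult_left[OF has_derivative_mult[OF pw[of p] this], of "f w"]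
    show "((\<lambda>\<mu>. \<mu> powi p * cnj \<mu> powi q * f w) has_derivative
        (\<lambda>\<nu>. (of_int p * \<nu> + of_int q * cnj \<nu>) * f w)) (at 1)"
      by (rule has_derivative_eq_rhs[OF *]) (simp add: fun_eq_iff algebra_simps)
    show "\<mu> powi p * cnj \<mu> powi q * f w = f (\<mu> *s w)" if "\<mu> \<in> - {0}" for \<mu>
      using assms(1,3) that by (simp add: bihom_def)
  qed auto
  ultimately have E: "D (\<nu> *s w) = (of_int p * \<nu> + of_int q * cnj \<nu>) * f w" for \<nu>
    using has_derivative_unique by metis
  note lin = has_derivative_linear[OF D]
  have exp: "D v = (\<Sum>k\<in>UNIV. of_real (Re (v $ k)) * D (axis k 1) + of_real (Im (v $ k)) * D (axis k \<i>))" for v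
  proof -
    have "(\<Sum>k\<in>UNIV. axis k (v $ k)) = v"
      by (simp add: vec_eq_iff axis_def)
    moreover have "D (\<Sum>k\<in>UNIV. axis k (v $ k)) = (\<Sum>k\<in>UNIV. D (axis k (v $ k)))"
      by (rule linear_sum[OF lin])
    ultimately have "D v = (\<Sum>k\<in>UNIV. D (axis k (v $ k)))"
      by (simp only:)
    also have "\<dots> = (\<Sum>k\<in>UNIV. of_real (Re (v $ k)) * D (axis k 1) + of_real (Im (v $ k)) * D (axis k \<i>))"
      by (intro sum.cong refl linear_axis[OF lin])
    finally show ?thesis .
  qed
  have w: "w $ k = of_real (Re (w $ k)) + \<i> * of_real (Im (w $ k))"
    "cnj (w $ k) = of_real (Re (w $ k)) - \<i> * of_real (Im (w $ k))" for k
    by (simp_all add: complex_eq_iff)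
  \<comment> \<open>By \<open>E\<close>, D w = (p + q) f w and D (i w) = i (p - q) f w. This
    combination leaves p f w; the one with the plus sign below leaves q f w.\<close>
  have "(\<Sum>k\<in>UNIV. w $ k * wirt 1 k f w) = (D (1 *s w) - \<i> * D (\<i> *s w)) / 2"
    unfolding exp[of "1 *s w"] exp[of "\<i> *s w"] wirt_eqI[OF D] sum_distrib_left sum_subtractf[symmetric] sum_divide_distrib
    by (intro sum.cong refl, subst w(1)) (simp add: algebra_simps)
  then show "(\<Sum>k\<in>UNIV. w $ k * wirt 1 k f w) = of_int p * f w"
    unfolding E by (simp add: algebra_simps)
  have "(\<Sum>k\<in>UNIV. cnj (w $ k) * wirt (-1) k f w) = (D (1 *s w) + \<i> * D (\<i> *s w)) / 2"
    unfolding exp[of "1 *s w"] exp[of "\<i> *s w"] wirt_eqI[OF D] sum_distrib_left sum.distrib[symmetric] sum_divide_distrib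
    by (intro sum.cong refl, subst w(2)) (simp add: algebra_simps)
  then show "(\<Sum>k\<in>UNIV. cnj (w $ k) * wirt (-1) k f w) = of_int q * f w"
    unfolding E by (simp add: algebra_simps)
qed

lemma bihom_divide:
  assumes "bihom p q f" "bihom p' q' g"
  shows "bihom (p - p') (q - q') (\<lambda>w. f w / g w)"
  using bihom_mult[OF assms(1) bihom_inverse[OF assms(2)]] by (simp add: divide_inverse)

lemma bihom_sum:
  assumes "\<And>i. i \<in> I \<Longrightarrow> bihom p q (f i)"
  shows "bihom p q (\<lambda>w. \<Sum>i\<in>I. f i w)"
  using assms by (simp add: bihom_def sum_distrib_left)

text \<open>\<open>matrix_inv\<close> is a choice among two-sided inverses, so its property follows
  once one exists.\<close>

lemma matrix_inv_inverse:
  fixes G :: "complex^2^2"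
  assumes "det G \<noteq> 0"
  shows "matrix_inv G ** G = mat 1"
proof -
  have "\<exists>H. G ** H = mat 1 \<and> H ** G = mat 1"
    using assms invertible_det_nz unfolding invertible_def by blast
  then show ?thesis
    unfolding matrix_inv_def by (rule someI2_ex) blast
qed

section \<open>The vertical geometry of a single fibre\<close>

text \<open>All derivatives in the theorem are vertical, so z is a mere parameter. The assumptions
  are what a Finsler function in coordinates gives on the fibre over z.\<close>

locale finsler_fibre =
  fixes F :: "2 local_finsler" and z :: "complex^2"
  assumes nonneg: "0 \<le> F (z, w)"
    and smooth_square: "smooth_on (- {0}) (\<lambda>w. (F (z, w))\<^sup>2)"
    and homogeneous: "F (z, \<mu> *s w) = cmod \<mu> * F (z, w)"
    and pos_def: "w \<noteq> 0 \<Longrightarrow> pos_def_hermitian (fund_mat F (z, w))"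
begin

definition L :: "complex^2 \<Rightarrow> complex" where
  "L w = of_real ((F (z, w))\<^sup>2)"

abbreviation d :: "2 \<Rightarrow> (complex^2 \<Rightarrow> complex) \<Rightarrow> complex^2 \<Rightarrow> complex" where
  "d \<equiv> wirt 1"

abbreviation db :: "2 \<Rightarrow> (complex^2 \<Rightarrow> complex) \<Rightarrow> complex^2 \<Rightarrow> complex" where
  "db \<equiv> wirt (-1)"

definition g :: "2 \<Rightarrow> 2 \<Rightarrow> complex^2 \<Rightarrow> complex" where
  "g i j = d i (db j L)"

text \<open>This is the coefficient \<open>C\<close> with its upper index lowered, see
  \<open>g_C\<close>; the third index is the barred one.\<close>

definition T :: "2 \<Rightarrow> 2 \<Rightarrow> 2 \<Rightarrow> complex^2 \<Rightarrow> complex" where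
  "T j k l = d k (g j l)"

text \<open>The last two indices are the barred ones. Up to sign, this is the fourth-derivative term
  of the curvature tensor.\<close>

definition X :: "2 \<Rightarrow> 2 \<Rightarrow> 2 \<Rightarrow> 2 \<Rightarrow> complex^2 \<Rightarrow> complex" where
  "X j k r h = db h (T j k r)"

definition L2 :: "2 \<Rightarrow> 2 \<Rightarrow> complex^2 \<Rightarrow> complex" where
  "L2 j k = d k (d j L)"

definition \<Delta> :: "complex^2 \<Rightarrow> complex" where
  "\<Delta> w = g 1 1 w * g 2 2 w - g 1 2 w * g 2 1 w"

text \<open>The unnormalised frame: \<open>m\<^sup>i = N\<^sup>i / \<surd>(L\<Delta>)\<close>, and \<open>M\<close> is proportional to \<open>m\<^sub>i\<close>.\<close>

definition N :: "2 \<Rightarrow> complex^2 \<Rightarrow> complex" where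
  "N i = (if i = 1 then (\<lambda>w. - d 2 L w) else d 1 L)"

definition M :: "2 \<Rightarrow> complex^2 \<Rightarrow> complex" where
  "M i w = (if i = 1 then - w $ 2 else w $ 1)"

definition Q :: "complex^2 \<Rightarrow> complex" where
  "Q w = (\<Sum>j\<in>UNIV. \<Sum>k\<in>UNIV. \<Sum>l\<in>UNIV. N j w * N k w * cnj (N l w) * T j k l w)"

definition Z :: "complex^2 \<Rightarrow> complex" where
  "Z w = (\<Sum>j\<in>UNIV. \<Sum>k\<in>UNIV. N j w * N k w * L2 j k w)"

definition Y :: "complex^2 \<Rightarrow> complex" where
  "Y w = (\<Sum>j\<in>UNIV. \<Sum>k\<in>UNIV. \<Sum>r\<in>UNIV. \<Sum>h\<in>UNIV.
     N j w * N k w * cnj (N r w) * cnj (N h w) * X j k r h w)"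

definition J :: "complex^2 \<Rightarrow> complex" where
  "J w = (Z w * cnj (Z w) / L w + Q w * cnj (Q w) / (L w * \<Delta> w) - Y w) / (L w * \<Delta> w)\<^sup>2"

section \<open>Restriction to the fibre, smoothness and conjugation symmetries of the
  tensors\<close>

lemma dv_fibre: "dv k f (z, w) = d k (\<lambda>w. f (z, w)) w"
  by (simp add: dv_def wirt_def Let_def)

lemma dvbar_fibre: "dvbar k f (z, w) = db k (\<lambda>w. f (z, w)) w"
  by (simp add: dvbar_def wirt_def Let_def)

lemma fund_fibre: "fund F i j (z, w) = g i j w"
  by (simp add: fund_def dv_fibre dvbar_fibre g_def L_def[abs_def])

lemma fund_mat_fibre: "fund_mat F (z, w) = (\<chi> i j. g i j w)"
  by (simp add: fund_mat_def fund_fibre)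

lemma smooth_L: "smooth_on (- {0}) L"
  unfolding L_def[abs_def] by (rule smooth_on_of_real[OF _ smooth_square]) auto

lemma open_slit: "open (- {0 :: complex^2})"
  by auto

lemmas smooth_wirt = smooth_on_wirt[OF open_slit]

lemma smooth_tensors:
  "smooth_on (- {0}) (wirt \<sigma> k L)" "smooth_on (- {0}) (g i j)" "smooth_on (- {0}) (T i j k)"
  "smooth_on (- {0}) (X i j k l)" "smooth_on (- {0}) (L2 i j)"
  unfolding g_def T_def X_def L2_def by (intro smooth_wirt smooth_L)+

lemmas differentiable_tensors =
  smooth_on_differentiable[OF smooth_L] smooth_tensors[THEN smooth_on_differentiable]

lemmas commute = wirt_commute[OF open_slit]

lemma wirt_cong_slit:
  fixes w :: "complex^2"
  assumes "w \<noteq> 0" "f differentiable (at w)" "\<And>x. x \<noteq> 0 \<Longrightarrow> f x = h x"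
  shows "wirt \<sigma> k f w = wirt \<sigma> k h w"
  by (rule wirt_cong[OF open_slit]) (use assms in auto)

lemma T_sym: "w \<noteq> 0 \<Longrightarrow> T j k l w = T k j l w"
  unfolding T_def g_def by (rule commute) (auto intro: smooth_wirt smooth_L)

lemma g_alt: "w \<noteq> 0 \<Longrightarrow> g i j w = db j (d i L) w"
  unfolding g_def by (rule commute) (auto intro: smooth_L)

lemma L2_sym: "w \<noteq> 0 \<Longrightarrow> L2 j k w = L2 k j w"
  unfolding L2_def by (rule commute) (auto intro: smooth_L)

lemma cnj_L: "cnj (L w) = L w"
  by (simp add: L_def)

text \<open>Transports a conjugation relation to first derivatives. Starting from the reality of
  \<open>L\<close> it yields in turn the symmetries of the first, second, third and fourth
  derivatives.\<close>

lemma cnj_wirt: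
  assumes "\<And>w. w \<noteq> 0 \<Longrightarrow> cnj (f w) = h w" "w \<noteq> 0" "smooth_on (- {0}) f"
  shows "cnj (d k f w) = db k h w" and "cnj (db k f w) = d k h w"
proof -
  have f: "f differentiable (at w)"
    using assms smooth_on_differentiable by blast
  have "wirt \<sigma> k h w = wirt \<sigma> k (\<lambda>w. cnj (f w)) w" for \<sigma>
    using assms(1,2) by (intro wirt_cong_slit[symmetric] wirt_cnj(1)[OF f]) auto
  then show "cnj (d k f w) = db k h w" "cnj (db k f w) = d k h w"
    by (simp_all add: wirt_cnj(2)[OF f])
qed

lemma cnj_d_L: "w \<noteq> 0 \<Longrightarrow> cnj (d k L w) = db k L w"
  and cnj_db_L: "w \<noteq> 0 \<Longrightarrow> cnj (db k L w) = d k L w"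
  using cnj_wirt[of L L] cnj_L smooth_L by auto

lemma cnj_g: "w \<noteq> 0 \<Longrightarrow> cnj (g i j w) = g j i w"
  unfolding g_alt[of _ j i] by (simp add: g_def cnj_wirt(1)[OF cnj_db_L _ smooth_tensors(1)])

lemma cnj_T: "w \<noteq> 0 \<Longrightarrow> cnj (T j k l w) = db k (g l j) w"
  unfolding T_def by (rule cnj_wirt(1)[OF cnj_g _ smooth_tensors(2)])

lemma db_g: "w \<noteq> 0 \<Longrightarrow> db k (g l j) w = cnj (T j k l w)"
  by (simp add: cnj_T)

lemma X_alt: "w \<noteq> 0 \<Longrightarrow> X j k r h w = d k (db h (g j r)) w"
  unfolding X_def T_def by (rule commute) (auto intro: smooth_tensors)

lemma cnj_X:
  assumes "w \<noteq> 0" shows "cnj (X j k r h w) = X r h j k w"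
proof -
  have "cnj (X j k r h w) = d h (db k (g r j)) w"
    unfolding X_def by (rule cnj_wirt(2)[OF cnj_T assms smooth_tensors(3)])
  then show ?thesis
    using assms by (simp add: X_alt)
qed

section \<open>Bidegrees and Euler relations\<close>

lemma bihom_L: "bihom 1 1 L"
  unfolding bihom_def L_def homogeneous
  by (simp add: power_mult_distrib complex_norm_square[symmetric] of_real_power[symmetric] del: of_real_power)

lemma bihom_tensors:
  "bihom 0 1 (d k L)" "bihom 1 0 (db k L)" "bihom 0 0 (g i j)" "bihom (-1) 0 (T i j k)"
  "bihom 0 (-1) (db k (g i j))" "bihom (-1) (-1) (X i j k l)" "bihom (-1) 1 (L2 i j)"
proof -
  show 1: "bihom 0 1 (d k L)" for k
    using bihom_wirt(1)[OF bihom_L differentiable_tensors(1)] by simp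
  show 2: "bihom 1 0 (db k L)" for k
    using bihom_wirt(2)[OF bihom_L differentiable_tensors(1)] by simp
  show 3: "bihom 0 0 (g i j)" for i j
    unfolding g_def using bihom_wirt(1)[OF 2 differentiable_tensors(2)] by simp
  show 4: "bihom (-1) 0 (T i j k)" for i j k
    unfolding T_def using bihom_wirt(1)[OF 3 differentiable_tensors(3)] by simp
  show "bihom 0 (-1) (db k (g i j))"
    using bihom_wirt(2)[OF 3 differentiable_tensors(3)] by simp
  show "bihom (-1) (-1) (X i j k l)"
    unfolding X_def using bihom_wirt(2)[OF 4 differentiable_tensors(4)] by simp
  show "bihom (-1) 1 (L2 i j)"
    unfolding L2_def using bihom_wirt(1)[OF 1 differentiable_tensors(2)] by simp
qed

lemma euler_L: "w \<noteq> 0 \<Longrightarrow> w $ 1 * d 1 L w + w $ 2 * d 2 L w = L w"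
  using euler(1)[OF bihom_L] differentiable_tensors(1) by (simp add: sum_2)

lemma euler_g:
  assumes "w \<noteq> 0"
  shows "g i 1 w * cnj (w $ 1) + g i 2 w * cnj (w $ 2) = d i L w"
  using euler(2)[OF bihom_tensors(1) differentiable_tensors(2), of w i] assms
  by (simp add: sum_2 g_alt algebra_simps)

lemma euler_g':
  assumes "w \<noteq> 0"
  shows "g 1 i w * w $ 1 + g 2 i w * w $ 2 = db i L w"
  using euler(1)[OF bihom_tensors(2) differentiable_tensors(2), of w i] assms
  by (simp add: sum_2 g_def algebra_simps)

lemma euler_T:
  assumes "w \<noteq> 0"
  shows "T j 1 l w * w $ 1 + T j 2 l w * w $ 2 = 0"
  using euler(1)[OF bihom_tensors(3) differentiable_tensors(3), of w j l] assms
  by (simp add: sum_2 T_def algebra_simps)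

text \<open>With the barred derivative moved outermost, \<open>T\<close> is the barred derivative of
  \<open>L2\<close>, whose barred degree is 1. Hence this contraction returns \<open>L2\<close>
  instead of vanishing.\<close>

lemma euler_T':
  assumes "w \<noteq> 0"
  shows "T j k 1 w * cnj (w $ 1) + T j k 2 w * cnj (w $ 2) = L2 j k w"
proof -
  have "T j k l w = db l (L2 j k) w" for l
  proof -
    have "T j k l w = d k (db l (d j L)) w"
      unfolding T_def using assms
      by (intro wirt_cong_slit differentiable_tensors) (auto simp: g_alt)
    also have "\<dots> = db l (L2 j k) w"
      unfolding L2_def using assms by (intro commute) (auto intro: smooth_tensors)
    finally show ?thesis .
  qed
  then show ?thesis
    using euler(2)[OF bihom_tensors(7) differentiable_tensors(6), of w j k] assms
    by (simp add: sum_2 algebra_simps)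
qed

lemma euler_X:
  assumes "w \<noteq> 0"
  shows "X j 1 r h w * w $ 1 + X j 2 r h w * w $ 2 = 0"
proof -
  have "db h (g j r) differentiable (at w)"
    using smooth_wirt[OF smooth_tensors(2)] assms smooth_on_differentiable by blast
  from euler(1)[OF bihom_tensors(5) this assms] show ?thesis
    using assms by (simp add: sum_2 X_alt algebra_simps)
qed

lemma euler_L2:
  assumes "w \<noteq> 0"
  shows "L2 j 1 w * w $ 1 + L2 j 2 w * w $ 2 = 0"
  using euler(1)[OF bihom_tensors(1) differentiable_tensors(2), of w j] assms
  by (simp add: sum_2 L2_def algebra_simps)

section \<open>Positivity of \<open>L\<close> and of the determinant\<close>

lemma L_expand:
  assumes "w \<noteq> 0"
  shows "L w = (\<Sum>i\<in>UNIV. \<Sum>j\<in>UNIV. g i j w * w $ i * cnj (w $ j))"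
proof -
  have "L w = w $ 1 * d 1 L w + w $ 2 * d 2 L w"
    by (rule euler_L[OF assms, symmetric])
  also have "\<dots> = w $ 1 * (g 1 1 w * cnj (w $ 1) + g 1 2 w * cnj (w $ 2))
      + w $ 2 * (g 2 1 w * cnj (w $ 1) + g 2 2 w * cnj (w $ 2))"
    by (simp only: euler_g[OF assms])
  finally show ?thesis
    by (simp only: sum_2 distrib_left mult_ac add.assoc)
qed

lemma hermitian_form_pos:
  assumes "w \<noteq> 0" "\<xi> \<noteq> 0"
  shows "0 < Re (\<Sum>i\<in>UNIV. \<Sum>j\<in>UNIV. g i j w * \<xi> $ i * cnj (\<xi> $ j))"
  using pos_def[OF assms(1), unfolded pos_def_hermitian_def, THEN conjunct2] assms(2)
  by (simp add: fund_mat_fibre)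

text \<open>By \<open>L_expand\<close>, \<open>L w\<close> is the Hermitian form evaluated at w
  itself.\<close>

lemma L_pos: assumes "w \<noteq> 0" shows "0 < Re (L w)" "Im (L w) = 0"
  using hermitian_form_pos[OF assms assms] unfolding L_expand[OF assms, symmetric]
  by (simp_all add: L_def)

lemma \<Delta>_pos: assumes "w \<noteq> 0" shows "0 < Re (\<Delta> w)" "Im (\<Delta> w) = 0"
proof -
  have cnj: "cnj (g 1 1 w) = g 1 1 w" "cnj (g 2 2 w) = g 2 2 w" "cnj (g 1 2 w) = g 2 1 w" "cnj (g 2 1 w) = g 1 2 w"
    using cnj_g[OF assms] by auto
  then have "cnj (\<Delta> w) = \<Delta> w"
    by (simp add: \<Delta>_def)
  then show im: "Im (\<Delta> w) = 0"
    by (simp add: complex_eq_iff)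
  have im1: "Im (g 1 1 w) = 0"
    using cnj(1) by (simp add: complex_eq_iff)
  have "(\<Sum>i\<in>UNIV. \<Sum>j\<in>UNIV. g i j w * axis 1 1 $ i * cnj (axis 1 1 $ j)) = g 1 1 w"
    by (simp add: sum_2 axis_def)
  then have g11: "0 < Re (g 1 1 w)"
    using hermitian_form_pos[OF assms, of "axis 1 1"] by (simp add: axis_eq_0_iff)
  \<comment> \<open>Gram-Schmidt without normalisation: \<xi> is orthogonal to the first coordinate
    vector, so that the form takes the value \<open>g 1 1 w * \<Delta> w\<close> on it.\<close>
  define \<xi> :: "complex^2" where "\<xi> = (\<chi> i. if i = 1 then - g 2 1 w else g 1 1 w)"
  have "\<xi> \<noteq> 0"
    using g11 by (auto simp: \<xi>_def vec_eq_iff forall_2)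
  moreover have "(\<Sum>i\<in>UNIV. \<Sum>j\<in>UNIV. g i j w * \<xi> $ i * cnj (\<xi> $ j)) = g 1 1 w * \<Delta> w"
    by (simp add: sum_2 \<xi>_def cnj \<Delta>_def algebra_simps)
  ultimately have "0 < Re (g 1 1 w) * Re (\<Delta> w)"
    using hermitian_form_pos[OF assms, of \<xi>] im1 im by simp
  then show "0 < Re (\<Delta> w)"
    using g11 by (simp add: zero_less_mult_iff)
qed

lemma nonzero: "w \<noteq> 0 \<Longrightarrow> L w \<noteq> 0" "w \<noteq> 0 \<Longrightarrow> \<Delta> w \<noteq> 0"
  using L_pos \<Delta>_pos by fastforce+

text \<open>The normalising factor of the frame, F times the root of the determinant. Under a single
  root stand smooth functions only.\<close>

definition E :: "complex^2 \<Rightarrow> complex" where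
  "E w = csqrt (L w * \<Delta> w)"

definition C :: "2 \<Rightarrow> 2 \<Rightarrow> 2 \<Rightarrow> complex^2 \<Rightarrow> complex" where
  "C i j k w = CF F i j k (z, w)"

lemma det_fund: "det (fund_mat F (z, w)) = \<Delta> w"
  by (simp add: fund_mat_fibre det_2 \<Delta>_def)

text \<open>\<open>L\<close> and \<Delta> are positive reals, so their product avoids the branch cut
  of \<open>csqrt\<close> and \<open>E\<close> is a nonzero real number.\<close>

lemma L_\<Delta>_positive:
  assumes "w \<noteq> 0"
  shows "L w * \<Delta> w \<notin> \<real>\<^sub>\<le>\<^sub>0" and "csqrt (\<Delta> w) \<noteq> 0" and "F (z, w) \<noteq> 0"
    and "E w = of_real (F (z, w)) * csqrt (\<Delta> w)" and "cnj (E w) = E w" and "cnj (\<Delta> w) = \<Delta> w"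
    and "E w \<noteq> 0"
proof -
  obtain a b where ab: "L w = of_real a" "\<Delta> w = of_real b" "0 < a" "0 < b"
    using L_pos[OF assms] \<Delta>_pos[OF assms] by (metis complex_is_Real_iff Re_complex_of_real Reals_cases)
  have F: "F (z, w) = sqrt a"
    using ab(1) real_sqrt_unique[OF _ nonneg[of w], of a] by (simp add: L_def del: of_real_power)
  have E: "E w = of_real (sqrt (a * b))"
    using ab by (simp add: E_def of_real_sqrt[symmetric] flip: of_real_mult)
  show "L w * \<Delta> w \<notin> \<real>\<^sub>\<le>\<^sub>0"
    using ab by (simp flip: of_real_mult add: complex_nonpos_Reals_iff mult_le_0_iff)
  show "csqrt (\<Delta> w) \<noteq> 0" "F (z, w) \<noteq> 0" "E w \<noteq> 0" "cnj (E w) = E w" "cnj (\<Delta> w) = \<Delta> w"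
    using ab by (simp_all add: F E)
  show "E w = of_real (F (z, w)) * csqrt (\<Delta> w)"
    using ab by (simp add: E F real_sqrt_mult csqrt_of_real_nonneg)
qed

lemma E_square: "(E w)\<^sup>2 = L w * \<Delta> w"
  by (simp add: E_def)

section \<open>The frame and the Chern-Finsler coefficients in the fibre\<close>

lemma l_up_fibre: "l_up F i (z, w) = w $ i / of_real (F (z, w))"
  by (simp add: l_up_def)

lemma l_low_fibre:
  assumes "w \<noteq> 0"
  shows "l_low F i (z, w) = d i L w / of_real (F (z, w))"
  by (simp add: l_low_def fund_fibre sum_2 euler_g[OF assms])

lemma m_up_fibre:
  assumes "w \<noteq> 0"
  shows "m_up F i (z, w) = N i w / E w"
  by (simp add: m_up_def l_low_fibre[OF assms] sqrt_g_def det_fund N_def L_\<Delta>_positive(4)[OF assms])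

lemma m_low_fibre: "m_low F i (z, w) = csqrt (\<Delta> w) * M i w / of_real (F (z, w))"
  by (simp add: m_low_def l_up_fibre sqrt_g_def det_fund M_def)

text \<open>Links the two versions of m: lowering the index of N-bar gives \<open>M\<close> up to
  \<Delta>. After expanding N-bar by \<open>euler_g'\<close>, one coordinate of w cancels and the
  other acquires the determinant as its factor.\<close>

lemma g_cnj_N:
  assumes "w \<noteq> 0"
  shows "g h 1 w * cnj (N 1 w) + g h 2 w * cnj (N 2 w) = \<Delta> w * M h w"
proof -
  have "h = 1 \<or> h = 2"
    using exhaust_2 by blast
  then show ?thesis
    by (auto simp: N_def M_def \<Delta>_def cnj_d_L[OF assms] algebra_simps simp flip: euler_g'[OF assms])
qed

text \<open>Lowering the index cancels the inverse matrix; later arguments use this equation in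
  place of the inverse.\<close>

lemma g_C:
  assumes "w \<noteq> 0"
  shows "g 1 r w * C 1 j k w + g 2 r w * C 2 j k w = T j k r w"
proof -
  define H where "H = matrix_inv (fund_mat F (z, w))"
  have "H ** fund_mat F (z, w) = mat 1"
    unfolding H_def using nonzero(2)[OF assms] by (intro matrix_inv_inverse) (simp add: det_fund)
  then have H: "H $ l $ 1 * g 1 r w + H $ l $ 2 * g 2 r w = (if l = r then 1 else 0)" for l
    by (simp add: vec_eq_iff matrix_matrix_mult_def mat_def sum_2 fund_mat_fibre)
  have "C i j k w = H $ 1 $ i * T j k 1 w + H $ 2 $ i * T j k 2 w" for i
    by (simp add: C_def CF_def fund_inv_def sum_2 dv_fibre fund_fibre H_def T_def)
  then have "g 1 r w * C 1 j k w + g 2 r w * C 2 j k w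
      = (H $ 1 $ 1 * g 1 r w + H $ 1 $ 2 * g 2 r w) * T j k 1 w
        + (H $ 2 $ 1 * g 1 r w + H $ 2 $ 2 * g 2 r w) * T j k 2 w"
    by (simp add: algebra_simps)
  then show ?thesis
    using exhaust_2[of r] by (auto simp: H)
qed

text \<open>The explicit solution of \<open>g_C\<close>, from which differentiability of
  \<open>C\<close> and its vanishing on w can be read off.\<close>

lemma C_cramer:
  assumes "w \<noteq> 0"
  shows "C 1 j k w = (g 2 2 w * T j k 1 w - g 2 1 w * T j k 2 w) / \<Delta> w"
    and "C 2 j k w = (g 1 1 w * T j k 2 w - g 1 2 w * T j k 1 w) / \<Delta> w"
  unfolding g_C[OF assms, symmetric]
  using nonzero(2)[OF assms] by (simp_all add: \<Delta>_def field_simps)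

section \<open>The curvature tensor in the fibre and its values along l and m\<close>

lemma cnj_differentiable: "f differentiable (at w) \<Longrightarrow> (\<lambda>w. cnj (f w)) differentiable (at w)"
  for f :: "complex^2 \<Rightarrow> complex"
  by (rule wirt_cnj(1))

lemma \<Delta>_differentiable: "w \<noteq> 0 \<Longrightarrow> \<Delta> differentiable (at w)"
  unfolding \<Delta>_def[abs_def] by (intro differentiable_diff differentiable_mult differentiable_tensors) auto

lemma N_differentiable: "w \<noteq> 0 \<Longrightarrow> N i differentiable (at w)"
  unfolding N_def by (auto intro!: differentiable_minus differentiable_tensors)

lemma differentiable_cong_slit:
  fixes f h :: "complex^2 \<Rightarrow> complex"
  assumes "w \<noteq> 0" "f differentiable (at w)" "\<And>x. x \<noteq> 0 \<Longrightarrow> h x = f x"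
  shows "h differentiable (at w)"
proof -
  obtain D where "(f has_derivative D) (at w)"
    using assms(2) by (auto simp: differentiable_def)
  then have "(h has_derivative D) (at w)"
    by (rule has_derivative_transform_within_open[OF _ open_slit]) (use assms in auto)
  then show ?thesis
    by (rule differentiableI)
qed

lemma C_differentiable:
  assumes "w \<noteq> 0"
  shows "C i j k differentiable (at w)"
proof -
  have *: "(\<lambda>w. (g a b w * T j k p w - g c e w * T j k q w) / \<Delta> w) differentiable (at w)" for a b p c e q
    using assms nonzero(2)
    by (intro differentiable_divide differentiable_diff differentiable_mult differentiable_tensors \<Delta>_differentiable) auto
  have "i = 1 \<or> i = 2"
    using exhaust_2 by blast
  then show ?thesis
    using differentiable_cong_slit[OF assms *[of 2 2 1 2 1 2], of "C 1 j k"] C_cramer(1)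
      differentiable_cong_slit[OF assms *[of 1 1 2 1 2 1], of "C 2 j k"] C_cramer(2)
    by auto
qed

text \<open>Differentiating \<open>g_C\<close> by the product rule expresses the lowered derivative
  of \<open>C\<close> through \<open>X\<close> and a product of first-order terms, so no derivative
  of \<open>C\<close> remains.\<close>

lemma vv_curv_fibre:
  assumes "w \<noteq> 0"
  shows "vv_curv F r j h k (z, w)
    = cnj (T r h 1 w) * C 1 j k w + cnj (T r h 2 w) * C 2 j k w - X j k r h w"
proof -
  have "X j k r h w = db h (\<lambda>w. g 1 r w * C 1 j k w + g 2 r w * C 2 j k w) w"
    unfolding X_def using assms g_C by (intro wirt_cong_slit differentiable_tensors) auto
  also have "\<dots> = db h (g 1 r) w * C 1 j k w + g 1 r w * db h (C 1 j k) w
      + (db h (g 2 r) w * C 2 j k w + g 2 r w * db h (C 2 j k) w)"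
    using assms by (simp add: wirt_add wirt_mult differentiable_tensors C_differentiable differentiable_mult)
  finally have "X j k r h w = \<dots>" .
  moreover have "vv_curv F r j h k (z, w) = - (g 1 r w * db h (C 1 j k) w + g 2 r w * db h (C 2 j k) w)"
    by (simp add: vv_curv_def sum_2 fund_fibre dvbar_fibre C_def[abs_def])
  ultimately show ?thesis
    using assms by (simp add: db_g)
qed

text \<open>Contracting the last index alone with w already gives zero: the terms in
  \<open>C\<close> vanish by \<open>euler_T\<close>, the one in \<open>X\<close> by
  \<open>euler_X\<close>.\<close>

lemma curv_l:
  assumes "w \<noteq> 0"
  shows "vert_sect_curv F (l_up F) (z, w) = 0"
proof -
  have l: "l_up F i (z, w) = of_real (1 / F (z, w)) * w $ i" for i
    by (simp add: l_up_fibre)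
  have C0: "C i j 1 w * w $ 1 + C i j 2 w * w $ 2 = 0" for i j
  proof -
    have "C 1 j 1 w * w $ 1 + C 1 j 2 w * w $ 2
        = (g 2 2 w * (T j 1 1 w * w $ 1 + T j 2 1 w * w $ 2)
          - g 2 1 w * (T j 1 2 w * w $ 1 + T j 2 2 w * w $ 2)) / \<Delta> w"
     "C 2 j 1 w * w $ 1 + C 2 j 2 w * w $ 2
        = (g 1 1 w * (T j 1 2 w * w $ 1 + T j 2 2 w * w $ 2)
          - g 1 2 w * (T j 1 1 w * w $ 1 + T j 2 1 w * w $ 2)) / \<Delta> w"
      by (simp_all add: C_cramer[OF assms] algebra_simps add_divide_distrib diff_divide_distrib)
    then show ?thesis
      using exhaust_2[of i] by (auto simp: euler_T[OF assms])
  qed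
  have null: "(\<Sum>k\<in>UNIV. vv_curv F r j h k (z, w) * w $ k) = 0" for r j h
  proof -
    have "(\<Sum>k\<in>UNIV. vv_curv F r j h k (z, w) * w $ k)
      = cnj (T r h 1 w) * (C 1 j 1 w * w $ 1 + C 1 j 2 w * w $ 2)
        + cnj (T r h 2 w) * (C 2 j 1 w * w $ 1 + C 2 j 2 w * w $ 2)
        - (X j 1 r h w * w $ 1 + X j 2 r h w * w $ 2)"
      by (simp add: sum_2 vv_curv_fibre[OF assms] algebra_simps)
    then show ?thesis
      by (simp add: C0 euler_X[OF assms])
  qed
  have "(\<Sum>k\<in>UNIV. vv_curv F r j h k (z, w) * cnj a * b * cnj c * (t * w $ k)) = 0" for r j h a b c t
  proof -
    have "(\<Sum>k\<in>UNIV. vv_curv F r j h k (z, w) * cnj a * b * cnj c * (t * w $ k))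
        = cnj a * b * cnj c * t * (\<Sum>k\<in>UNIV. vv_curv F r j h k (z, w) * w $ k)"
      by (simp add: sum_distrib_left algebra_simps)
    then show ?thesis
      using null by simp
  qed
  then show ?thesis
    by (simp only: vert_sect_curv_def l sum.neutral_const mult_zero_right)
qed

text \<open>Expands a covector in the frame dual to w-bar and N-bar. The derivatives of
  \<open>L\<close> and the conjugate of \<open>M\<close> form this dual frame up to the factor
  \<open>L\<close>: the diagonal pairings are \<open>L\<close>, the others 0.\<close>

lemma frame_decomposition:
  fixes t :: "2 \<Rightarrow> complex"
  assumes "w \<noteq> 0"
  shows "L w * t r = db r L w * (cnj (w $ 1) * t 1 + cnj (w $ 2) * t 2)
    + cnj (M r w) * (cnj (N 1 w) * t 1 + cnj (N 2 w) * t 2)"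
proof -
  have "cnj (L w) = cnj (w $ 1) * db 1 L w + cnj (w $ 2) * db 2 L w"
    unfolding euler_L[OF assms, symmetric] by (simp add: cnj_d_L[OF assms])
  then show ?thesis
    using exhaust_2[of r] by (auto simp: cnj_L N_def M_def cnj_d_L[OF assms] algebra_simps)
qed

text \<open>By \<open>g_cnj_N\<close>, \<Delta> times \<open>M\<close> is the lowered N-bar, and
  lowering the index of \<open>C\<close> gives \<open>T\<close>.\<close>

lemma M_C:
  assumes "w \<noteq> 0"
  shows "\<Delta> w * (M 1 w * C 1 j k w + M 2 w * C 2 j k w) = cnj (N 1 w) * T j k 1 w + cnj (N 2 w) * T j k 2 w"
proof -
  have "\<Delta> w * (M 1 w * C 1 j k w + M 2 w * C 2 j k w)
      = (\<Delta> w * M 1 w) * C 1 j k w + (\<Delta> w * M 2 w) * C 2 j k w"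
    by (simp add: algebra_simps)
  also have "\<dots> = cnj (N 1 w) * (g 1 1 w * C 1 j k w + g 2 1 w * C 2 j k w)
      + cnj (N 2 w) * (g 1 2 w * C 1 j k w + g 2 2 w * C 2 j k w)"
    unfolding g_cnj_N[OF assms, symmetric] by (simp add: algebra_simps)
  finally show ?thesis
    by (simp add: g_C[OF assms])
qed

lemma B_fibre:
  assumes "w \<noteq> 0"
  shows "B_inv F (z, w) = Q w / E w ^ 3"
proof -
  define s where "s = csqrt (\<Delta> w)"
  define f where "f = complex_of_real (F (z, w))"
  have s: "s \<noteq> 0" "f \<noteq> 0" "E w = f * s" "\<Delta> w = s\<^sup>2"
    using L_\<Delta>_positive[OF assms] by (simp_all add: s_def f_def)
  have *: "s\<^sup>2 * (M 1 w * C 1 j k w + M 2 w * C 2 j k w) = cnj (N 1 w) * T j k 1 w + cnj (N 2 w) * T j k 2 w" for j k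
    using M_C[OF assms] s(4) by simp
  \<comment> \<open>\<open>m_low\<close> contributes s / f and the two \<open>m_up\<close>
    contribute 1 / (f s)^2. Moving s^2 into the bracket completes the denominator to (f
    s)^3.\<close>
  have "B_inv F (z, w) = (\<Sum>j\<in>UNIV. \<Sum>k\<in>UNIV. N j w * N k w * (s\<^sup>2 * (M 1 w * C 1 j k w + M 2 w * C 2 j k w))) / (f * s) ^ 3"
    using s(1,2) unfolding B_inv_def m_up_fibre[OF assms] m_low_fibre C_def[symmetric] s_def[symmetric] f_def[symmetric] s(3)
    by (simp add: sum_2 field_simps power2_eq_square power3_eq_cube)
  also have "\<dots> = Q w / E w ^ 3"
    unfolding * s(3) Q_def by (simp add: sum_2 algebra_simps)
  finally show ?thesis .
qed

text \<open>Its pairings with N-bar and w-bar are \<open>Q\<close> and \<open>Z\<close>, which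
  therefore determine it by \<open>frame_decomposition\<close>.\<close>

definition t :: "2 \<Rightarrow> complex^2 \<Rightarrow> complex" where
  "t l w = (\<Sum>j\<in>UNIV. \<Sum>k\<in>UNIV. N j w * N k w * T j k l w)"

lemma Q_t: "Q w = cnj (N 1 w) * t 1 w + cnj (N 2 w) * t 2 w"
  by (simp add: Q_def t_def sum_2 algebra_simps)

lemma Z_t:
  assumes "w \<noteq> 0"
  shows "Z w = cnj (w $ 1) * t 1 w + cnj (w $ 2) * t 2 w"
  by (simp add: Z_def t_def sum_2 euler_T'[OF assms, symmetric] algebra_simps)

text \<open>The part quadratic in third derivatives is the squared length of the vector
  \<open>c\<close>, whose lowered form is \<open>t\<close>. Splitting it along w and N gives the
  terms with \<open>Z\<close> and \<open>Q\<close>; the fourth derivatives give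
  \<open>Y\<close>.\<close>

lemma curv_m:
  assumes "w \<noteq> 0"
  shows "vert_sect_curv F (m_up F) (z, w) = 2 * J w"
proof -
  define c where "c i = (\<Sum>j\<in>UNIV. \<Sum>k\<in>UNIV. N j w * N k w * C i j k w)" for i
  have "vert_sect_curv F (m_up F) (z, w) = 2 * ((cnj (t 1 w) * c 1 + cnj (t 2 w) * c 2 - Y w) / E w ^ 4)"
  proof -
    define e where "e = inverse (E w)"
    have e: "cnj e = e" "m_up F i (z, w) = N i w * e" for i
      by (simp_all add: e_def L_\<Delta>_positive(5)[OF assms] m_up_fibre[OF assms] divide_inverse)
    have e4: "u / E w ^ 4 = u * e * e * e * e" for u
      by (simp add: e_def divide_inverse power4_eq_xxxx)
    show ?thesis
      unfolding vert_sect_curv_def e(2) e4 vv_curv_fibre[OF assms] c_def t_def Y_def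
      by (simp add: sum_2 e(1) algebra_simps)
  qed
  moreover have "cnj (t 1 w) * c 1 + cnj (t 2 w) * c 2 = Z w * cnj (Z w) / L w + Q w * cnj (Q w) / (L w * \<Delta> w)"
  proof -
    have gc: "g 1 r w * c 1 + g 2 r w * c 2 = t r w" for r
      unfolding c_def t_def g_C[OF assms, symmetric] by (simp add: sum_2 algebra_simps)
    have Mc: "\<Delta> w * (M 1 w * c 1 + M 2 w * c 2) = Q w"
    proof -
      have "\<Delta> w * (M 1 w * c 1 + M 2 w * c 2) = (\<Delta> w * M 1 w) * c 1 + (\<Delta> w * M 2 w) * c 2"
        by (simp add: algebra_simps)
      also have "\<dots> = cnj (N 1 w) * (g 1 1 w * c 1 + g 2 1 w * c 2) + cnj (N 2 w) * (g 1 2 w * c 1 + g 2 2 w * c 2)"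
        unfolding g_cnj_N[OF assms, symmetric] by (simp add: algebra_simps)
      finally show ?thesis by (simp add: gc Q_t)
    qed
    have Lc: "d 1 L w * c 1 + d 2 L w * c 2 = Z w"
    proof -
      have "d 1 L w * c 1 + d 2 L w * c 2
         = cnj (w $ 1) * (g 1 1 w * c 1 + g 2 1 w * c 2) + cnj (w $ 2) * (g 1 2 w * c 1 + g 2 2 w * c 2)"
        unfolding euler_g[OF assms, symmetric] by (simp add: algebra_simps)
      then show ?thesis by (simp add: gc Z_t[OF assms])
    qed
    \<comment> \<open>The conjugate of the decomposition of \<open>t\<close>; it reduces the length
      to the pairings of \<open>c\<close> with the derivative of \<open>L\<close> and with
      \<open>M\<close>, computed in \<open>Lc\<close> and \<open>Mc\<close>.\<close>
    have tr: "L w * cnj (t r w) = d r L w * cnj (Z w) + M r w * cnj (Q w)" for r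
    proof -
      have "L w * t r w = db r L w * Z w + cnj (M r w) * Q w"
        unfolding Q_t Z_t[OF assms] by (rule frame_decomposition[OF assms])
      from arg_cong[OF this, of cnj] show ?thesis
        by (simp add: cnj_L cnj_db_L[OF assms])
    qed
    have "L w * (cnj (t 1 w) * c 1 + cnj (t 2 w) * c 2) = (L w * cnj (t 1 w)) * c 1 + (L w * cnj (t 2 w)) * c 2"
      by (simp add: algebra_simps)
    also have "\<dots> = cnj (Z w) * (d 1 L w * c 1 + d 2 L w * c 2) + cnj (Q w) * (M 1 w * c 1 + M 2 w * c 2)"
      unfolding tr by (simp add: algebra_simps)
    also have "M 1 w * c 1 + M 2 w * c 2 = Q w / \<Delta> w"
      using Mc nonzero(2)[OF assms] by (simp add: field_simps)
    finally show ?thesis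
      unfolding Lc using nonzero[OF assms] by (simp add: field_simps)
  qed
  moreover have "E w ^ 4 = (L w * \<Delta> w)\<^sup>2"
    by (simp add: E_square[symmetric] flip: power_mult)
  ultimately show ?thesis
    by (simp add: J_def)
qed

section \<open>Derivatives along N-bar and the curvature invariant\<close>

lemma L_frame:
  assumes "w \<noteq> 0"
  shows "N 2 w * w $ 1 - N 1 w * w $ 2 = L w"
  using euler_L[OF assms] by (simp add: N_def algebra_simps)

text \<open>N spans the complex tangent line of the level set of \<open>L\<close> in the
  fibre.\<close>

lemma cnj_N_db_L:
  assumes "w \<noteq> 0"
  shows "cnj (N 1 w) * db 1 L w + cnj (N 2 w) * db 2 L w = 0"
  by (simp add: N_def cnj_d_L[OF assms])

text \<open>The logarithmic derivative of \<open>\<Delta>\<close> along \<open>m\<close>-bar is the conjugate of \<open>B\<close>.\<close>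

lemma N_d_\<Delta>:
  assumes "w \<noteq> 0"
  shows "L w * (cnj (N 1 w) * db 1 \<Delta> w + cnj (N 2 w) * db 2 \<Delta> w) = cnj (Q w)"
proof -
  define u where "u i l = cnj (N 1 w) * db 1 (g i l) w + cnj (N 2 w) * db 2 (g i l) w" for i l
  have D: "db s \<Delta> w = db s (g 1 1) w * g 2 2 w + g 1 1 w * db s (g 2 2) w
      - (db s (g 1 2) w * g 2 1 w + g 1 2 w * db s (g 2 1) w)" for s
    unfolding \<Delta>_def[abs_def] using assms
    by (simp add: wirt_diff wirt_mult differentiable_tensors differentiable_mult)
  have 1: "cnj (N 1 w) * db 1 \<Delta> w + cnj (N 2 w) * db 2 \<Delta> w
      = u 1 1 * g 2 2 w + g 1 1 w * u 2 2 - (u 1 2 * g 2 1 w + g 1 2 w * u 2 1)"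
    unfolding D u_def by (simp add: algebra_simps)
  have 2: "cnj (Q w) = N 1 w * (cnj (N 1 w) * u 1 1 + cnj (N 2 w) * u 1 2)
      + N 2 w * (cnj (N 1 w) * u 2 1 + cnj (N 2 w) * u 2 2)"
    unfolding Q_def u_def db_g[OF assms]
    by (simp add: sum_2 T_sym[OF assms, of 2 1] algebra_simps)
  have u: "u i 1 * cnj (w $ 1) + u i 2 * cnj (w $ 2) = 0" for i
  proof -
    have "cnj (T 1 s i w) * cnj (w $ 1) + cnj (T 2 s i w) * cnj (w $ 2) = 0" for s
      using arg_cong[OF euler_T[OF assms, of s i], of cnj] T_sym[OF assms, of s]
      by simp
    moreover have "u i 1 * cnj (w $ 1) + u i 2 * cnj (w $ 2)
      = cnj (N 1 w) * (cnj (T 1 1 i w) * cnj (w $ 1) + cnj (T 2 1 i w) * cnj (w $ 2))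
      + cnj (N 2 w) * (cnj (T 1 2 i w) * cnj (w $ 1) + cnj (T 2 2 i w) * cnj (w $ 2))"
      unfolding u_def db_g[OF assms] by (simp add: algebra_simps)
    ultimately show ?thesis by simp
  qed
  have N: "N 1 w = - (g 2 1 w * cnj (w $ 1) + g 2 2 w * cnj (w $ 2))"
    "N 2 w = g 1 1 w * cnj (w $ 1) + g 1 2 w * cnj (w $ 2)"
    by (simp_all add: N_def euler_g[OF assms])
  have cN: "cnj (N 1 w) = - (g 1 2 w * w $ 1 + g 2 2 w * w $ 2)"
    "cnj (N 2 w) = g 1 1 w * w $ 1 + g 2 1 w * w $ 2"
    by (simp_all add: N_def cnj_d_L[OF assms] euler_g'[OF assms])
  have L: "L w = N 2 w * w $ 1 - N 1 w * w $ 2"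
    using L_frame[OF assms] by simp
  \<comment> \<open>The form \<open>u\<close> annihilates w-bar, so the trace of the inverse of
    \<open>g\<close> times \<open>u\<close> reduces to its value on N and N-bar. In coordinates this
    is a polynomial identity modulo the Euler relations.\<close>
  have "(N2 * w1 - N1 * w2) * (u11 * g22 + g11 * u22 - (u12 * g21 + g12 * u21))
      = N1 * (cN1 * u11 + cN2 * u12) + N2 * (cN1 * u21 + cN2 * u22)"
    if "u11 * cw1 + u12 * cw2 = 0" "u21 * cw1 + u22 * cw2 = 0"
      "N1 = - (g21 * cw1 + g22 * cw2)" "N2 = g11 * cw1 + g12 * cw2"
      "cN1 = - (g12 * w1 + g22 * w2)" "cN2 = g11 * w1 + g21 * w2"
    for u11 u12 u21 u22 g11 g12 g21 g22 w1 w2 cw1 cw2 N1 N2 cN1 cN2 :: complex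
    using that by algebra
  from this[OF u u N cN] show ?thesis
    unfolding 1 2 L .
qed

text \<open>The barred derivatives of N are entries of \<open>g\<close>, so the sum is a lowered
  N-bar and \<open>g_cnj_N\<close> applies. That the result is a multiple of w makes
  \<open>euler_T\<close> applicable in \<open>N_d_Q\<close>.\<close>

lemma N_d_N:
  assumes "w \<noteq> 0"
  shows "cnj (N 1 w) * db 1 (N k) w + cnj (N 2 w) * db 2 (N k) w = - \<Delta> w * w $ k"
proof -
  have "db s (N 1) w = - g 2 s w" "db s (N 2) w = g 1 s w" for s
    using assms by (simp_all add: N_def wirt_minus differentiable_tensors g_alt)
  then show ?thesis
    using g_cnj_N[OF assms, of 1] g_cnj_N[OF assms, of 2] exhaust_2[of k]
    by (auto simp: M_def algebra_simps)
qed

text \<open>The symmetric matrix \<open>L2\<close> annihilates w. Its contraction with N is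
  therefore a multiple of \<open>M\<close>, with coefficient found by pairing with N once more; that
  pairing is \<open>Z\<close>. The claim is the conjugate.\<close>

lemma N_d_cnj_N:
  assumes "w \<noteq> 0"
  shows "L w * (cnj (N 1 w) * db 1 (\<lambda>w. cnj (N l w)) w + cnj (N 2 w) * db 2 (\<lambda>w. cnj (N l w)) w)
    = - cnj (Z w) * cnj (w $ l)"
proof -
  have dN: "d s (N 1) w = - L2 2 s w" "d s (N 2) w = L2 1 s w" for s
    using assms by (simp_all add: N_def wirt_minus differentiable_tensors L2_def)
  have "L w * (N 1 w * d 1 (N l) w + N 2 w * d 2 (N l) w) = - Z w * w $ l"
  proof -
    have "Z w = N 1 w * N 1 w * L2 1 1 w + 2 * N 1 w * N 2 w * L2 1 2 w + N 2 w * N 2 w * L2 2 2 w"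
      by (simp add: Z_def sum_2 L2_sym[OF assms, of 2 1])
    moreover note euler_L2[OF assms, of 1] euler_L2[OF assms, of 2] L2_sym[OF assms, of 2 1]
      L_frame[OF assms, symmetric]
    ultimately have "L w * (N 1 w * L2 2 1 w + N 2 w * L2 2 2 w) = Z w * w $ 1"
      "L w * (N 1 w * L2 1 1 w + N 2 w * L2 1 2 w) = - Z w * w $ 2"
      by algebra+
    then show ?thesis
      using exhaust_2[of l] by (auto simp: dN algebra_simps)
  qed
  from arg_cong[OF this, of cnj] show ?thesis
    by (simp add: wirt_cnj(2)[OF N_differentiable[OF assms]] cnj_L)
qed

lemma Q_differentiable: "w \<noteq> 0 \<Longrightarrow> Q differentiable (at w)"
  and Z_differentiable: "w \<noteq> 0 \<Longrightarrow> Z differentiable (at w)"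
  and Y_differentiable: "w \<noteq> 0 \<Longrightarrow> Y differentiable (at w)"
  unfolding Q_def[abs_def] Z_def[abs_def] Y_def[abs_def] sum_2
  by (intro differentiable_add differentiable_mult differentiable_tensors N_differentiable cnj_differentiable; simp)+

text \<open>Product rule: the derivatives of the factors N drop out, that of N-bar gives the term in
  \<open>Z\<close> via \<open>N_d_cnj_N\<close>, and that of \<open>T\<close> gives
  \<open>Y\<close>.\<close>

lemma N_d_Q:
  assumes "w \<noteq> 0"
  shows "cnj (N 1 w) * db 1 Q w + cnj (N 2 w) * db 2 Q w = Y w - Z w * cnj (Z w) / L w"
proof -
  let ?n = "\<lambda>f. cnj (N 1 w) * db 1 f w + cnj (N 2 w) * db 2 f w"
  have mult: "?n (\<lambda>w. f w * h w) = ?n f * h w + f w * ?n h"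
    if "f differentiable (at w)" "h differentiable (at w)" for f h
    using that by (simp add: wirt_mult algebra_simps)
  have add: "?n (\<lambda>w. f w + h w) = ?n f + ?n h"
    if "f differentiable (at w)" "h differentiable (at w)" for f h
    using that by (simp add: wirt_add algebra_simps)
  have NT: "?n (T j k l) = cnj (N 1 w) * X j k l 1 w + cnj (N 2 w) * X j k l 2 w" for j k l
    by (simp add: X_def)
  have Nb: "?n (\<lambda>w. cnj (N l w)) = - cnj (Z w) * cnj (w $ l) / L w" for l
    using N_d_cnj_N[OF assms, of l] nonzero[OF assms] by (simp add: field_simps)
  have dT: "(\<lambda>w. N j w * N k w * cnj (N l w) * T j k l w) differentiable (at w)"
    "(\<lambda>w. N j w * N k w * cnj (N l w)) differentiable (at w)"
    "(\<lambda>w. N j w * N k w) differentiable (at w)" "N j differentiable (at w)"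
    "(\<lambda>w. cnj (N l w)) differentiable (at w)" "T j k l differentiable (at w)" for j k l
    using assms by (intro differentiable_mult differentiable_tensors N_differentiable cnj_differentiable; simp)+
  have summand: "?n (\<lambda>w. N j w * N k w * cnj (N l w) * T j k l w)
     = - \<Delta> w * cnj (N l w) * (w $ j * N k w + N j w * w $ k) * T j k l w
       - cnj (Z w) / L w * (N j w * N k w * cnj (w $ l) * T j k l w)
       + N j w * N k w * cnj (N l w) * (cnj (N 1 w) * X j k l 1 w + cnj (N 2 w) * X j k l 2 w)" for j k l
    unfolding mult[OF dT(2,6)] mult[OF dT(3,5)] mult[OF dT(4,4)] NT Nb N_d_N[OF assms]
    by (simp add: algebra_simps)
  have "?n Q = (\<Sum>j\<in>UNIV. \<Sum>k\<in>UNIV. \<Sum>l\<in>UNIV. ?n (\<lambda>w. N j w * N k w * cnj (N l w) * T j k l w))"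
    unfolding Q_def[abs_def] sum_2 by (simp only: add differentiable_add dT add.assoc)
  also have "\<dots> = (\<Sum>j\<in>UNIV. \<Sum>k\<in>UNIV. \<Sum>l\<in>UNIV. - \<Delta> w * cnj (N l w) * (w $ j * N k w + N j w * w $ k) * T j k l w)
      - cnj (Z w) / L w * (\<Sum>j\<in>UNIV. \<Sum>k\<in>UNIV. \<Sum>l\<in>UNIV. N j w * N k w * cnj (w $ l) * T j k l w) + Y w"
    unfolding summand Y_def by (simp add: sum_2 algebra_simps)
  also have "(\<Sum>j\<in>UNIV. \<Sum>k\<in>UNIV. \<Sum>l\<in>UNIV. N j w * N k w * cnj (w $ l) * T j k l w) = Z w"
    unfolding Z_t[OF assms] t_def by (simp add: sum_2 algebra_simps)
  \<comment> \<open>Symmetry of \<open>T\<close> in its unbarred indices merges the two terms and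
    exhibits the contraction with w that \<open>euler_T\<close> annihilates.\<close>
  also have "(\<Sum>j\<in>UNIV. \<Sum>k\<in>UNIV. \<Sum>l\<in>UNIV. - \<Delta> w * cnj (N l w) * (w $ j * N k w + N j w * w $ k) * T j k l w)
     = - 2 * \<Delta> w * (\<Sum>j\<in>UNIV. \<Sum>l\<in>UNIV. cnj (N l w) * N j w * (T j 1 l w * w $ 1 + T j 2 l w * w $ 2))"
    by (simp add: sum_2 T_sym[OF assms, of 2 1] algebra_simps)
  finally show ?thesis
    by (simp add: euler_T[OF assms])
qed

text \<open>Differentiate the square of \<open>E\<close>, which is \<open>L\<close> times \<Delta>:
  the derivative of \<open>L\<close> along N-bar vanishes and that of \<Delta> is given by
  \<open>N_d_\<Delta>\<close>.\<close>

lemma N_d_E: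
  assumes "w \<noteq> 0"
  shows "E differentiable (at w)"
    and "2 * E w * (cnj (N 1 w) * db 1 E w + cnj (N 2 w) * db 2 E w) = cnj (Q w)"
proof -
  have LD: "(\<lambda>w. L w * \<Delta> w) differentiable (at w)"
    using assms by (intro differentiable_mult differentiable_tensors \<Delta>_differentiable) auto
  note ch = wirt_chain[OF LD has_field_derivative_csqrt[OF L_\<Delta>_positive(1)[OF assms]]]
  show "E differentiable (at w)"
    unfolding E_def[abs_def] by (rule ch(1))
  have dE: "2 * E w * db s E w = db s L w * \<Delta> w + L w * db s \<Delta> w" for s
  proof -
    have "db s E w = inverse (2 * E w) * db s (\<lambda>w. L w * \<Delta> w) w"
      unfolding E_def[abs_def] by (rule ch(2))
    also have "db s (\<lambda>w. L w * \<Delta> w) w = db s L w * \<Delta> w + L w * db s \<Delta> w"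
      using assms by (intro wirt_mult differentiable_tensors \<Delta>_differentiable) auto
    finally have "2 * E w * db s E w
        = (2 * E w * inverse (2 * E w)) * (db s L w * \<Delta> w + L w * db s \<Delta> w)"
      by (simp only: mult.assoc)
    moreover have "2 * E w \<noteq> 0"
      using L_\<Delta>_positive(7)[OF assms] by simp
    ultimately show ?thesis
      by (simp only: right_inverse mult_1 not_False_eq_True)
  qed
  have "2 * E w * (cnj (N 1 w) * db 1 E w + cnj (N 2 w) * db 2 E w)
      = cnj (N 1 w) * (2 * E w * db 1 E w) + cnj (N 2 w) * (2 * E w * db 2 E w)"
    by (simp add: algebra_simps)
  also have "\<dots> = \<Delta> w * (cnj (N 1 w) * db 1 L w + cnj (N 2 w) * db 2 L w)
        + L w * (cnj (N 1 w) * db 1 \<Delta> w + cnj (N 2 w) * db 2 \<Delta> w)"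
    unfolding dE by (simp add: algebra_simps)
  finally show "2 * E w * (cnj (N 1 w) * db 1 E w + cnj (N 2 w) * db 2 E w) = cnj (Q w)"
    by (simp add: N_d_\<Delta>[OF assms] cnj_N_db_L[OF assms])
qed

text \<open>Differentiating the inverse cube of \<open>E\<close> contributes 3/2 times |Q|^2 / E^6
  to the invariant, and the term -1/2 |B|^2 lowers the coefficient to 1, the one found in
  \<open>curv_m\<close>.\<close>

lemma vert_curv_inv_fibre:
  assumes "w \<noteq> 0"
  shows "vert_curv_inv F (z, w) = J w"
proof -
  let ?n = "\<lambda>f. cnj (N 1 w) * db 1 f w + cnj (N 2 w) * db 2 f w"
  have E0: "E w \<noteq> 0" and cE: "cnj (E w) = E w"
    using L_\<Delta>_positive[OF assms] by auto
  note ED = N_d_E(1)[OF assms]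
  have D: "((\<lambda>x. inverse (x ^ 3)) has_field_derivative (- 3 / E w ^ 4)) (at (E w))"
    using E0 by (auto intro!: derivative_eq_intros simp: field_simps eval_nat_numeral)
  note inv = wirt_chain[OF ED D]
  have "db s (\<lambda>w. B_inv F (z, w)) w = db s (\<lambda>w. Q w * inverse (E w ^ 3)) w" for s
    by (intro wirt_cong_slit[symmetric] assms differentiable_mult Q_differentiable inv(1))
      (simp add: B_fibre divide_inverse)
  then have dB: "db s (\<lambda>w. B_inv F (z, w)) w = db s Q w / E w ^ 3 - 3 * Q w * db s E w / E w ^ 4" for s
    using assms by (simp add: wirt_mult inv Q_differentiable divide_inverse)
  have nE: "?n E = cnj (Q w) / (2 * E w)"
    using N_d_E(2)[OF assms] E0 by (simp add: field_simps)
  have "(\<Sum>s\<in>UNIV. dvbar s (B_inv F) (z, w) * cnj (m_up F s (z, w)))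
     = (?n Q / E w ^ 3 - 3 * Q w * ?n E / E w ^ 4) / E w"
    by (simp add: sum_2 dvbar_fibre dB m_up_fibre[OF assms] cE diff_divide_distrib add_divide_distrib algebra_simps)
  also have "\<dots> = (Y w - Z w * cnj (Z w) / L w) / E w ^ 4 - 3 / 2 * (Q w * cnj (Q w)) / E w ^ 6"
    unfolding nE N_d_Q[OF assms] using E0 by (simp add: field_simps eval_nat_numeral)
  finally have "vert_curv_inv F (z, w)
      = - ((Y w - Z w * cnj (Z w) / L w) / E w ^ 4 - 3 / 2 * (Q w * cnj (Q w)) / E w ^ 6)
        - 1 / 2 * (Q w / E w ^ 3) * cnj (Q w / E w ^ 3)"
    by (simp only: vert_curv_inv_def B_fibre[OF assms])
  also have "\<dots> = (Z w * cnj (Z w) / L w - Y w) / E w ^ 4 + Q w * cnj (Q w) / E w ^ 6"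
    using E0 nonzero[OF assms] by (simp add: cE field_simps eval_nat_numeral)
  finally have I: "vert_curv_inv F (z, w)
      = (Z w * cnj (Z w) / L w - Y w) / E w ^ 4 + Q w * cnj (Q w) / E w ^ 6" .
  have "E w ^ 6 = (L w * \<Delta> w) ^ 3" "E w ^ 4 = (L w * \<Delta> w)\<^sup>2"
    by (simp_all add: E_square[symmetric] flip: power_mult)
  then have "vert_curv_inv F (z, w)
      = (Z w * cnj (Z w) / L w - Y w) / (L w * \<Delta> w)\<^sup>2 + Q w * cnj (Q w) / (L w * \<Delta> w) ^ 3"
    unfolding I by (simp only:)
  also have "\<dots> = J w"
    using nonzero[OF assms]
    by (simp add: J_def add_divide_distrib diff_divide_distrib power2_eq_square power3_eq_cube)
  finally show ?thesis .
qed

section \<open>Reality and homogeneity of the common value \<open>J\<close>\<close>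

lemma J_real:
  assumes "w \<noteq> 0"
  shows "J w \<in> \<real>"
proof -
  \<comment> \<open>Conjugation swaps the barred and unbarred pairs of indices of \<open>X\<close>,
    and with them the factors N and N-bar.\<close>
  have "cnj (Y w) = Y w"
    by (simp add: Y_def sum_2 cnj_X[OF assms] algebra_simps)
  then have "cnj (J w) = J w"
    by (simp add: J_def cnj_L L_\<Delta>_positive(6)[OF assms] mult.commute)
  then show ?thesis
    by (simp add: Reals_cnj_iff)
qed

lemma J_differentiable:
  assumes "w \<noteq> 0"
  shows "J differentiable (at w)"
  unfolding J_def[abs_def] power2_eq_square
  using nonzero assms
  by (intro differentiable_divide differentiable_diff differentiable_add differentiable_mult
      differentiable_tensors \<Delta>_differentiable Q_differentiable Z_differentiable Y_differentiable cnj_differentiable) auto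

lemma bihom_N: "bihom 0 1 (N i)"
  unfolding N_def using bihom_tensors(1) by (auto intro: bihom_minus)

text \<open>Each of the three terms of the numerator has bidegree (1, 1), and the denominator has
  (2, 2).\<close>

lemma bihom_J: "bihom (-1) (-1) J"
proof -
  note N = bihom_N bihom_cnj[OF bihom_N, simplified]
  have \<Delta>: "bihom 0 0 \<Delta>"
    unfolding \<Delta>_def[abs_def]
    using bihom_diff[OF bihom_mult[OF bihom_tensors(3,3)] bihom_mult[OF bihom_tensors(3,3)]] by simp
  have Q: "bihom 0 2 Q"
    unfolding Q_def[abs_def]
    using bihom_mult[OF bihom_mult[OF bihom_mult[OF N(1,1)] N(2)] bihom_tensors(4)]
    by (intro bihom_sum) simp
  have Z: "bihom (-1) 3 Z"
    unfolding Z_def[abs_def]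
    using bihom_mult[OF bihom_mult[OF N(1,1)] bihom_tensors(7)] by (intro bihom_sum) simp
  have Y: "bihom 1 1 Y"
    unfolding Y_def[abs_def]
    using bihom_mult[OF bihom_mult[OF bihom_mult[OF bihom_mult[OF N(1,1)] N(2)] N(2)] bihom_tensors(6)]
    by (intro bihom_sum) simp
  have LD: "bihom 1 1 (\<lambda>w. L w * \<Delta> w)"
    using bihom_mult[OF bihom_L \<Delta>] by simp
  have "bihom 1 1 (\<lambda>w. Z w * cnj (Z w) / L w)"
    using bihom_divide[OF bihom_mult[OF Z bihom_cnj[OF Z]] bihom_L] by simp
  moreover have "bihom 1 1 (\<lambda>w. Q w * cnj (Q w) / (L w * \<Delta> w))"
    using bihom_divide[OF bihom_mult[OF Q bihom_cnj[OF Q]] LD] by simp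
  ultimately have "bihom 1 1 (\<lambda>w. Z w * cnj (Z w) / L w + Q w * cnj (Q w) / (L w * \<Delta> w) - Y w)"
    by (intro bihom_diff bihom_add Y)
  from bihom_divide[OF this bihom_mult[OF LD LD]] show ?thesis
    by (simp add: J_def[abs_def] power2_eq_square)
qed

lemma dv0_curv:
  assumes "w \<noteq> 0"
  shows "dv0 (vert_curv_inv F) (z, w) = - vert_curv_inv F (z, w)"
proof -
  have "d k (\<lambda>w. vert_curv_inv F (z, w)) w = d k J w" for k
    by (intro wirt_cong_slit[symmetric] assms J_differentiable) (simp add: vert_curv_inv_fibre)
  then show ?thesis
    using euler(1)[OF bihom_J J_differentiable[OF assms] assms]
    by (simp add: dv0_def dv_fibre vert_curv_inv_fibre[OF assms])
qed

end

section \<open>Coordinates on the holomorphic tangent bundle\<close>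

context
  fixes M :: "'a topology" and A :: "('a, 'n::finite) chart set"
  assumes manifold: "complex_manifold M A"
begin

lemma chart_inj: "c \<in> A \<Longrightarrow> inj_on (chart_map c) (chart_dom c)"
  and chart_openin: "c \<in> A \<Longrightarrow> openin M (chart_dom c)"
  and chart_range_open: "c \<in> A \<Longrightarrow> open (chart_range c)"
  and chart_homeomorphic: "c \<in> A \<Longrightarrow>
    homeomorphic_map (subtopology M (chart_dom c)) (top_of_set (chart_range c)) (chart_map c)"
proof -
  assume c: "c \<in> A"
  then show o: "openin M (chart_dom c)" "open (chart_range c)"
    and h: "homeomorphic_map (subtopology M (chart_dom c)) (top_of_set (chart_range c)) (chart_map c)"
    using manifold unfolding complex_manifold_def by blast+
  have "topspace (subtopology M (chart_dom c)) = chart_dom c"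
    using openin_subset[OF o(1)] by auto
  then show "inj_on (chart_map c) (chart_dom c)"
    using homeomorphic_imp_injective_map[OF h] by simp
qed

lemma chart_overlap_open:
  assumes "c \<in> A" "d \<in> A"
  shows "open (chart_map c ` (chart_dom c \<inter> chart_dom d))"
proof -
  have "openin (subtopology M (chart_dom c)) (chart_dom c \<inter> chart_dom d)"
    by (intro openin_subtopology_Int2 chart_openin assms)
  then have "openin (top_of_set (chart_range c)) (chart_map c ` (chart_dom c \<inter> chart_dom d))"
    using homeomorphic_imp_open_map[OF chart_homeomorphic[OF assms(1)]] unfolding open_map_def by blast
  then show ?thesis
    using chart_range_open[OF assms(1)] openin_open_trans by blast
qed

lemma transition_apply:
  assumes "c \<in> A" "p \<in> chart_dom c"
  shows "transition c d (chart_map c p) = chart_map d p"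
  by (simp add: transition_def inv_into_f_f[OF chart_inj[OF assms(1)] assms(2)])

text \<open>The Jacobian of a holomorphic map is a complex matrix, so it commutes with complex
  scalars; this makes each fibre a complex vector space.\<close>

lemma transition_derivative:
  assumes "c \<in> A" "d \<in> A" "p \<in> chart_dom c" "p \<in> chart_dom d"
  shows "(transition c d has_derivative frechet_derivative (transition c d) (at (chart_map c p))) (at (chart_map c p))"
    and "frechet_derivative (transition c d) (at (chart_map c p)) (\<mu> *s v)
      = \<mu> *s frechet_derivative (transition c d) (at (chart_map c p)) v"
proof -
  have "holomorphic_map_on (chart_map c ` (chart_dom c \<inter> chart_dom d)) (transition c d)"
    using manifold assms unfolding complex_manifold_def by blast
  then obtain K :: "complex^'n^'n" where K: "(transition c d has_derivative (\<lambda>h. K *v h)) (at (chart_map c p))"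
    using assms unfolding holomorphic_map_on_def by blast
  then have D: "frechet_derivative (transition c d) (at (chart_map c p)) = (\<lambda>h. K *v h)"
    using frechet_derivative_at by metis
  show "(transition c d has_derivative frechet_derivative (transition c d) (at (chart_map c p))) (at (chart_map c p))"
    unfolding D by (rule K)
  show "frechet_derivative (transition c d) (at (chart_map c p)) (\<mu> *s v)
      = \<mu> *s frechet_derivative (transition c d) (at (chart_map c p)) v"
    unfolding D by (simp add: vector_scalar_commute)
qed

text \<open>The chain rule: \<open>transition c e\<close> agrees with the composite on the image of
  the overlap of c and d, which is open.\<close>

lemma transition_cocycle:
  assumes "c \<in> A" "d \<in> A" "e \<in> A" "p \<in> chart_dom c" "p \<in> chart_dom d" "p \<in> chart_dom e"
  shows "frechet_derivative (transition d e) (at (chart_map d p))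
      (frechet_derivative (transition c d) (at (chart_map c p)) v)
    = frechet_derivative (transition c e) (at (chart_map c p)) v"
proof -
  let ?S = "chart_map c ` (chart_dom c \<inter> chart_dom d)"
  have "((transition d e \<circ> transition c d) has_derivative
      frechet_derivative (transition d e) (at (chart_map d p)) \<circ> frechet_derivative (transition c d) (at (chart_map c p)))
      (at (chart_map c p))"
    using transition_derivative(1)[of c d p] transition_derivative(1)[of d e p] assms
    by (intro diff_chain_at) (simp_all add: transition_apply)
  then have "(transition c e has_derivative
      frechet_derivative (transition d e) (at (chart_map d p)) \<circ> frechet_derivative (transition c d) (at (chart_map c p)))
      (at (chart_map c p))"
    by (rule has_derivative_transform_within_open[OF _ chart_overlap_open[OF assms(1,2)]])
      (use assms in \<open>auto simp: transition_apply\<close>)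
  from frechet_derivative_at[OF this] show ?thesis
    by (metis comp_apply)
qed

lemma transition_self:
  assumes "c \<in> A" "p \<in> chart_dom c"
  shows "frechet_derivative (transition c c) (at (chart_map c p)) v = v"
proof -
  have "(transition c c has_derivative (\<lambda>v. v)) (at (chart_map c p))"
    by (rule has_derivative_transform_within_open[OF has_derivative_ident chart_range_open[OF assms(1)]])
      (use assms in \<open>auto simp: transition_apply\<close>)
  from frechet_derivative_at[OF this] show ?thesis
    by metis
qed

lemma tangent_determined:
  assumes "v \<in> hol_tangent_space A p" "v' \<in> hol_tangent_space A p" "c \<in> A" "p \<in> chart_dom c" "v c = v' c"
  shows "v = v'"
proof
  fix d
  show "v d = v' d"
  proof (cases "d \<in> A \<and> p \<in> chart_dom d")
    case True
    have "u d = frechet_derivative (transition c d) (at (chart_map c p)) (u c)"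
      if "u \<in> hol_tangent_space A p" for u
      using that True assms(3,4) unfolding hol_tangent_space_def by blast
    from this[OF assms(1)] this[OF assms(2)] show ?thesis
      by (simp only: assms(5))
  next
    case False
    have "u d = 0" if "u \<in> hol_tangent_space A p" for u
      using that False unfolding hol_tangent_space_def by blast
    from this[OF assms(1)] this[OF assms(2)] show ?thesis
      by simp
  qed
qed

text \<open>The components in the other charts are obtained from \<eta> by the Jacobians; the
  cocycle rule makes the family consistent.\<close>

lemma tangent_exists:
  assumes "c \<in> A" "p \<in> chart_dom c"
  shows "\<exists>v\<in>hol_tangent_space A p. v c = \<eta>"
proof
  define v where "v d = (if d \<in> A \<and> p \<in> chart_dom d
    then frechet_derivative (transition c d) (at (chart_map c p)) \<eta> else 0)" for d
  show "v \<in> hol_tangent_space A p"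
    using assms by (auto simp: hol_tangent_space_def v_def transition_cocycle)
  show "v c = \<eta>"
    using assms by (simp add: v_def transition_self)
qed

lemma tangent_smult:
  assumes "v \<in> hol_tangent_space A p"
  shows "(\<lambda>c. \<mu> *s v c) \<in> hol_tangent_space A p"
  unfolding hol_tangent_space_def
proof (intro CollectI conjI allI ballI impI)
  fix c assume "\<not> (c \<in> A \<and> p \<in> chart_dom c)"
  then have "v c = 0"
    using assms unfolding hol_tangent_space_def by blast
  then show "\<mu> *s v c = 0"
    by simp
next
  fix c d assume cd: "c \<in> A" "d \<in> A" "p \<in> chart_dom c \<inter> chart_dom d"
  then have "v d = frechet_derivative (transition c d) (at (chart_map c p)) (v c)"
    using assms unfolding hol_tangent_space_def by blast
  then show "\<mu> *s v d = frechet_derivative (transition c d) (at (chart_map c p)) (\<mu> *s v c)"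
    using cd by (simp add: transition_derivative(2))
qed

text \<open>The bundle coordinates are injective over the chart domain, because a tangent vector is
  determined by its components in one chart; hence \<open>inv_into\<close> recovers (p, v).\<close>

lemma in_coords_apply:
  assumes "c \<in> A" "p \<in> chart_dom c" "v \<in> hol_tangent_space A p"
  shows "in_coords M A c f (chart_map c p, v c) = f (p, v)"
proof -
  let ?S = "{x \<in> hol_tangent_bundle M A. fst x \<in> chart_dom c}"
  have "inj_on (bundle_coords c) ?S"
  proof (rule inj_onI, clarify)
    fix q u q' u'
    assume S: "(q, u) \<in> hol_tangent_bundle M A" "fst (q, u) \<in> chart_dom c"
        "(q', u') \<in> hol_tangent_bundle M A" "fst (q', u') \<in> chart_dom c"
      and eq: "bundle_coords c (q, u) = bundle_coords c (q', u')"
    have "q = q'"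
      using S eq by (intro inj_onD[OF chart_inj[OF assms(1)]]) (simp_all add: bundle_coords_def)
    moreover have "u = u'"
      using S eq \<open>q = q'\<close>
      by (intro tangent_determined[OF _ _ assms(1), of _ q]) (simp_all add: bundle_coords_def hol_tangent_bundle_def)
    ultimately show "q = q' \<and> u = u'" ..
  qed
  moreover have "(p, v) \<in> ?S"
    using assms openin_subset[OF chart_openin[OF assms(1)]] by (auto simp: hol_tangent_bundle_def)
  ultimately have "inv_into ?S (bundle_coords c) (bundle_coords c (p, v)) = (p, v)"
    by (rule inv_into_f_f)
  then show ?thesis
    by (simp add: in_coords_def bundle_coords_def)
qed

end

lemma finsler_fibre_in_coords:
  fixes F :: "'a \<times> ('a, 2) tangent \<Rightarrow> real"
  assumes "complex_finsler_space M A F" "c \<in> A" "z \<in> chart_range c"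
  shows "finsler_fibre (in_coords M A c F) z"
proof -
  have mfd: "complex_manifold M A"
    and nonneg: "\<forall>x\<in>hol_tangent_bundle M A. 0 \<le> F x"
    and smooth: "\<forall>c\<in>A. smooth_on (chart_range c \<times> (UNIV - {0})) (in_coords M A c (\<lambda>x. (F x)\<^sup>2))"
    and hom: "\<forall>(p, v)\<in>hol_tangent_bundle M A. \<forall>\<mu>::complex. F (p, \<lambda>c. \<mu> *s v c) = cmod \<mu> * F (p, v)"
    and pos: "\<forall>c\<in>A. \<forall>z\<in>chart_range c. \<forall>\<eta>. \<eta> \<noteq> 0 \<longrightarrow>
        pos_def_hermitian (fund_mat (in_coords M A c F) (z, \<eta>))"
    using assms(1) unfolding complex_finsler_space_def by - (elim conjE, assumption)+
  obtain p where p: "p \<in> chart_dom c" "z = chart_map c p"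
    using assms(3) by auto
  \<comment> \<open>Every coordinate vector comes from a tangent vector at p, so conditions on the
    bundle become conditions on the whole coordinate fibre.\<close>
  have vec: "\<exists>v\<in>hol_tangent_space A p. v c = \<eta>" for \<eta>
    by (rule tangent_exists[OF mfd assms(2) p(1)])
  have in_bundle: "(p, v) \<in> hol_tangent_bundle M A" if "v \<in> hol_tangent_space A p" for v
    using that p(1) openin_subset[OF chart_openin[OF mfd assms(2)]] by (auto simp: hol_tangent_bundle_def)
  note coords = in_coords_apply[OF mfd assms(2) p(1), folded p(2)]
  show ?thesis
  proof
    fix w :: "complex^2" and \<mu> :: complex
    obtain v where v: "v \<in> hol_tangent_space A p" "v c = w"
      using vec by blast
    show "0 \<le> in_coords M A c F (z, w)"
      using coords[OF v(1), of F] bspec[OF nonneg in_bundle[OF v(1)]] v(2) by simp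
    show "in_coords M A c F (z, \<mu> *s w) = cmod \<mu> * in_coords M A c F (z, w)"
      using coords[OF v(1), of F] coords[OF tangent_smult[OF mfd v(1)], of F \<mu>] bspec[OF hom in_bundle[OF v(1)]] v(2)
      by simp
    show "pos_def_hermitian (fund_mat (in_coords M A c F) (z, w))" if "w \<noteq> 0"
      using pos assms(2,3) that by blast
  next
    have "Ck_on n (- {0}) (\<lambda>w. in_coords M A c (\<lambda>x. (F x)\<^sup>2) (z, w))" for n
      using smooth assms(2,3)
      by (intro Ck_on_slice[of _ _ "chart_range c"]) (auto simp: smooth_on_def Compl_eq_Diff_UNIV)
    then show "smooth_on (- {0}) (\<lambda>w. (in_coords M A c F (z, w))\<^sup>2)"
      by (simp add: smooth_on_def in_coords_def)
  qed
qed

theorem theorem4p1: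
  fixes M :: "'a topology"
    and A :: "('a, 2) chart set"
    and F :: "'a \<times> ('a, 2) tangent \<Rightarrow> real"
    and c :: "('a, 2) chart"
    and z \<eta> :: "complex^2"
    and F\<^sub>c :: "2 local_finsler"
  assumes "complex_finsler_space M A F"
    and "c \<in> A"
    and "z \<in> chart_range c"
    and "\<eta> \<noteq> 0"
    and "F\<^sub>c = in_coords M A c F"
  shows "vert_sect_curv F\<^sub>c (l_up F\<^sub>c) (z, \<eta>) = 0
    \<and> vert_sect_curv F\<^sub>c (m_up F\<^sub>c) (z, \<eta>) = 2 * vert_curv_inv F\<^sub>c (z, \<eta>)
    \<and> vert_curv_inv F\<^sub>c (z, \<eta>) \<in> \<real>
    \<and> dv0 (vert_curv_inv F\<^sub>c) (z, \<eta>) = - vert_curv_inv F\<^sub>c (z, \<eta>)"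
proof -
  interpret finsler_fibre F\<^sub>c z
    unfolding assms(5) by (rule finsler_fibre_in_coords[OF assms(1-3)])
  show ?thesis
    using curv_l[OF assms(4)] curv_m[OF assms(4)] vert_curv_inv_fibre[OF assms(4)] J_real[OF assms(4)]
      dv0_curv[OF assms(4)] by simp
qed

end
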